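(* Consider the optimization problem $$\max_{\boldsymbol{x}\in\mathcal{X}}\ \min_{\boldsymbol{c}\in\mathcal{U}}\ \sum_{i=1}^n (1-c_i)x_i,$$ where $\mathcal{X}\subseteq\{0,1\}^n$ and $\mathcal{U}=\left\{\boldsymbol{c}\in\{0,1\}^n : \sum_{i=1}^n w_ic_i\le B\right\}$ with $\boldsymbol{w}\in\mathbb{N}^n$, $B\in\mathbb{N}$ and $w_i\le B$ for all $i\in\{1,\ldots,n\}$. This problem is not approximable, even if the nominal problem $\max_{\boldsymbol{x}\in\mathcal{X}}\sum_{i=1}^n x_i$ can be solved in polynomial time. That is, there is a class of feasible sets $\mathcal{X}$ for which the nominal problem $\max_{\boldsymbol{x}\in\mathcal{X}}\sum_{i=1}^n x_i$ is solvable in polynomial time, but such that, unless P $=$ NP, for no $\alpha>0$ is there a polynomial-time $\alpha$-approximation algorithm for the max-min problem over this class of feasible sets.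
   Context: An instance consists of $\boldsymbol{w}$, $B$ and a description of the feasible set $\mathcal{X}$ (for example, by a polynomial-size system of linear inequalities over binary variables), with all numbers encoded in binary. For $\alpha>0$, an $\alpha$-approximation algorithm for a maximization problem with nonnegative objective returns, for every instance with a nonempty feasible set and optimal value $\mathrm{OPT}$, a feasible solution with objective value at least $\alpha\cdot\mathrm{OPT}$. The objective value of $\boldsymbol{x}\in\mathcal{X}$ in the max-min problem is $\min_{\boldsymbol{c}\in\mathcal{U}}\sum_{i=1}^n(1-c_i)x_i$. *)

theory Defs
  imports Complex_Main
begin

section \<open>Deterministic multi-tape Turing machines\<close>

text \<open>
  A machine has \<open>tapes\<close> two-way infinite tapes, control states \<open>{..<states}\<close> and tape
  symbols \<open>{..<symbols}\<close>. Symbol 0 is the blank, symbols 1 and 2 stand for the bits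
  \<open>False\<close> and \<open>True\<close>, further symbols are work symbols. State 0 is initial, state 1 is
  the only halting state. The transition function maps a state and the list of scanned
  symbols to a new state and, for each tape, a symbol to write and a move in \<open>{-1, 0, 1}\<close>.
\<close>

record tm =
  tapes :: nat
  states :: nat
  symbols :: nat
  delta :: "nat \<Rightarrow> nat list \<Rightarrow> nat \<times> (nat \<times> int) list"

definition turing_machine :: "tm \<Rightarrow> bool" where
  "turing_machine M \<longleftrightarrow>
     tapes M \<ge> 1 \<and> states M \<ge> 2 \<and> symbols M \<ge> 3 \<and>
     (\<forall>q ss. q < states M \<and> length ss = tapes M \<and> set ss \<subseteq> {..<symbols M} \<longrightarrow>
        fst (delta M q ss) < states M \<and>
        length (snd (delta M q ss)) = tapes M \<and>
        set (snd (delta M q ss)) \<subseteq> {..<symbols M} \<times> {-1, 0, 1})"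

text \<open>
  Tapes are stored relative to the head, which always scans cell 0; moving the head by
  \<open>m\<close> shifts the contents instead.
\<close>

type_synonym tape = "int \<Rightarrow> nat"
type_synonym config = "nat \<times> tape list"

definition act :: "nat \<times> int \<Rightarrow> tape \<Rightarrow> tape" where
  "act a t = (\<lambda>i. (t(0 := fst a)) (i + snd a))"

definition step :: "tm \<Rightarrow> config \<Rightarrow> config" where
  "step M c = (if fst c = 1 then c else
     let r = delta M (fst c) (map (\<lambda>t. t 0) (snd c))
     in (fst r, map2 act (snd r) (snd c)))"

definition bit_symbol :: "bool \<Rightarrow> nat" where
  "bit_symbol b = (if b then 2 else 1)"

definition input_tape :: "bool list \<Rightarrow> tape" where
  "input_tape x = (\<lambda>i. if 0 \<le> i \<and> i < int (length x) then bit_symbol (x ! nat i) else 0)"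

definition initial :: "tm \<Rightarrow> bool list \<Rightarrow> config" where
  "initial M x = (0, input_tape x # replicate (tapes M - 1) (\<lambda>_. 0))"

text \<open>The output is the block of bits from the head of the first tape to the next blank.\<close>

definition output_is :: "config \<Rightarrow> bool list \<Rightarrow> bool" where
  "output_is c y \<longleftrightarrow>
     (\<forall>i < length y. hd (snd c) (int i) = bit_symbol (y ! i)) \<and> hd (snd c) (int (length y)) = 0"

definition computes_within :: "tm \<Rightarrow> bool list \<Rightarrow> bool list \<Rightarrow> nat \<Rightarrow> bool" where
  "computes_within M x y t \<longleftrightarrow>
     fst ((step M ^^ t) (initial M x)) = 1 \<and> output_is ((step M ^^ t) (initial M x)) y"


section \<open>Polynomial time, P and NP\<close>

text \<open>
  A search problem consists of a set \<open>I\<close> of instances, an encoding \<open>enc\<close> of instances as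
  bit strings, and a relation \<open>R\<close> between instances and acceptable answers.
\<close>

definition polytime_solvable ::
    "('i \<Rightarrow> bool list) \<Rightarrow> 'i set \<Rightarrow> ('i \<Rightarrow> bool list \<Rightarrow> bool) \<Rightarrow> bool" where
  "polytime_solvable enc I R \<longleftrightarrow>
     (\<exists>M a k. turing_machine M \<and>
        (\<forall>i\<in>I. \<exists>y. R i y \<and> computes_within M (enc i) y (a * length (enc i) ^ k + a)))"

definition PTIME :: "bool list set set" where
  "PTIME = {L. polytime_solvable (\<lambda>x. x) UNIV (\<lambda>x y. y = [x \<in> L])}"

text \<open>Each bit of the first component is preceded by \<open>True\<close>; a single \<open>False\<close> ends it.\<close>

definition pair_code :: "bool list \<Rightarrow> bool list \<Rightarrow> bool list" where
  "pair_code u v = concat (map (\<lambda>b. [True, b]) u) @ False # v"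

definition NP :: "bool list set set" where
  "NP = {L. \<exists>V\<in>PTIME. \<exists>a k. \<forall>x.
          x \<in> L \<longleftrightarrow> (\<exists>u. length u \<le> a * length x ^ k + a \<and> pair_code x u \<in> V)}"


section \<open>Classes of feasible sets\<close>

text \<open>Vectors in \<open>{0,1}\<^sup>n\<close> are bit lists, with coordinates numbered from 0.\<close>

definition cube :: "nat \<Rightarrow> bool list set" where
  "cube n = {x. length x = n}"

text \<open>
  A description \<open>(n, s)\<close> of a feasible set gives the number \<open>n\<close> of variables and a bit
  string \<open>s\<close>, for example an encoded system of linear inequalities. A class of feasible
  sets is a set \<open>D\<close> of descriptions with a map \<open>X\<close> sending a description to the feasible
  set it describes. For \<open>X\<close> to be a legitimate way of describing sets, feasibility of a
  given vector must be checkable in polynomial time, as is the case for linear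
  inequalities; otherwise undecidable sets could be hidden in \<open>X\<close>.
  The number of variables is written in unary, so that its code is about as
  long as a vector in \<open>{0,1}\<^sup>n\<close>.
\<close>

type_synonym description = "nat \<times> bool list"

definition desc_code :: "description \<Rightarrow> bool list" where
  "desc_code d = replicate (fst d) True @ False # snd d"

definition feasible_set_class :: "description set \<Rightarrow> (description \<Rightarrow> bool list set) \<Rightarrow> bool" where
  "feasible_set_class D X \<longleftrightarrow>
     (\<forall>d\<in>D. X d \<subseteq> cube (fst d)) \<and>
     polytime_solvable (\<lambda>(d, x). pair_code (desc_code d) x) (D \<times> UNIV)
       (\<lambda>(d, x) y. y = [x \<in> X d])"


section \<open>The nominal problem\<close>

definition nominal_value :: "bool list \<Rightarrow> nat" where
  "nominal_value x = (\<Sum>i<length x. of_bool (x ! i))"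

text \<open>
  On an empty feasible set the answer is arbitrary; emptiness is then recognised by
  testing feasibility of the answer, which is possible in polynomial time.
\<close>

definition nominal_polytime :: "description set \<Rightarrow> (description \<Rightarrow> bool list set) \<Rightarrow> bool" where
  "nominal_polytime D X \<longleftrightarrow>
     polytime_solvable desc_code D
       (\<lambda>d y. X d \<noteq> {} \<longrightarrow> y \<in> X d \<and> (\<forall>x\<in>X d. nominal_value x \<le> nominal_value y))"


section \<open>The max-min problem\<close>

definition uncertainty_set :: "nat list \<Rightarrow> nat \<Rightarrow> bool list set" where
  "uncertainty_set w B = {c \<in> cube (length w). (\<Sum>i<length w. w ! i * of_bool (c ! i)) \<le> B}"

definition maxmin_value :: "nat list \<Rightarrow> nat \<Rightarrow> bool list \<Rightarrow> int" where
  "maxmin_value w B x =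
     Min ((\<lambda>c. \<Sum>i<length w. (1 - of_bool (c ! i)) * of_bool (x ! i)) ` uncertainty_set w B)"

definition maxmin_opt :: "nat list \<Rightarrow> nat \<Rightarrow> bool list set \<Rightarrow> int" where
  "maxmin_opt w B S = Max (maxmin_value w B ` S)"

text \<open>Binary digits, least significant first.\<close>

fun binary :: "nat \<Rightarrow> bool list" where
  "binary m = (if m = 0 then [] else odd m # binary (m div 2))"

declare binary.simps [simp del]

type_synonym maxmin_instance = "description \<times> nat list \<times> nat"

definition maxmin_instances :: "description set \<Rightarrow> maxmin_instance set" where
  "maxmin_instances D =
     {(d, w, B). d \<in> D \<and> length w = fst d \<and> (\<forall>i<length w. w ! i \<le> B)}"

definition instance_code :: "maxmin_instance \<Rightarrow> bool list" where
  "instance_code = (\<lambda>(d, w, B).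
     pair_code (desc_code d) (concat (map (\<lambda>m. pair_code (binary m) []) (B # w))))"

definition maxmin_approximable ::
    "real \<Rightarrow> description set \<Rightarrow> (description \<Rightarrow> bool list set) \<Rightarrow> bool" where
  "maxmin_approximable \<alpha> D X \<longleftrightarrow>
     polytime_solvable instance_code (maxmin_instances D)
       (\<lambda>(d, w, B) y. X d \<noteq> {} \<longrightarrow>
          y \<in> X d \<and> real_of_int (maxmin_value w B y) \<ge> \<alpha> * real_of_int (maxmin_opt w B (X d)))"


section \<open>The codes are unambiguous\<close>

lemma pair_code_inject: "pair_code u v = pair_code u' v' \<longleftrightarrow> u = u' \<and> v = v'"
proof (induction u arbitrary: u')
  case Nil
  show ?case by (cases u') (auto simp: pair_code_def)
next
  case (Cons b u)
  then show ?case by (cases u') (auto simp: pair_code_def)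
qed

lemma desc_code_inject: "desc_code d = desc_code d' \<longleftrightarrow> d = d'"
proof -
  have "replicate n True @ False # s = replicate n' True @ False # s' \<longleftrightarrow> n = n' \<and> s = s'"
    for n n' s s'
  proof (induction n arbitrary: n')
    case 0
    show ?case by (cases n') auto
  next
    case (Suc n)
    then show ?case by (cases n') auto
  qed
  then show ?thesis by (simp add: desc_code_def prod_eq_iff)
qed

lemma binary_inject: "binary m = binary m' \<longleftrightarrow> m = m'"
proof (induction m arbitrary: m' rule: less_induct)
  case (less m)
  show ?case
  proof (cases "m = 0 \<or> m' = 0")
    case True
    then show ?thesis by (auto simp: binary.simps[of m] binary.simps[of m'] binary.simps[of 0])
  next
    case False
    then have "binary (m div 2) = binary (m' div 2) \<longleftrightarrow> m div 2 = m' div 2"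
      by (intro less) auto
    moreover have "m = m' \<longleftrightarrow> odd m = odd m' \<and> m div 2 = m' div 2"
      by (metis bit_eq_rec)
    ultimately show ?thesis
      using False by (simp add: binary.simps[of m] binary.simps[of m'])
  qed
qed

lemma instance_code_inject: "instance_code i = instance_code i' \<longleftrightarrow> i = i'"
proof -
  let ?code = "\<lambda>ms. concat (map (\<lambda>m. pair_code (binary m) []) ms)"
  have Cons: "?code (m # ms) = pair_code (binary m) (?code ms)" for m ms
    by (simp add: pair_code_def)
  have nonempty: "pair_code u v \<noteq> []" for u v
    by (simp add: pair_code_def)
  have "?code ms = ?code ms' \<longleftrightarrow> ms = ms'" for ms ms'
  proof (induction ms arbitrary: ms')
    case Nil
    show ?case
    proof (cases ms')
      case (Cons m' r')
      then show ?thesis using nonempty by simp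
    qed simp
  next
    case IH: (Cons m ms)
    show ?case
    proof (cases ms')
      case Nil
      then show ?thesis using nonempty by simp
    next
      case ms': (Cons m' r')
      then show ?thesis
        by (simp only: Cons pair_code_inject binary_inject IH list.inject)
    qed
  qed
  then show ?thesis
    unfolding instance_code_def
    by (simp only: case_prod_beta pair_code_inject desc_code_inject list.inject prod_eq_iff) blast
qed

end

theory Submission
  imports Defs
begin

text \<open>
  Let \<open>L\<close> be in NP but not in P, with verifier \<open>V\<close> and witnesses of length at most
  \<open>p(|s|) = a|s|\<^sup>k + a\<close>. For \<open>n = p(|s|) + 3\<close> the feasible set of \<open>(n, s)\<close> consists of all vectors
  \<open>False z\<close> and of the vectors \<open>True\<^sup>j False u\<close> with \<open>j \<ge> 2\<close> where \<open>u\<close> is a witness for \<open>s\<close>. No feasible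
  vector is all ones, so \<open>False True\<^sup>n\<^sup>-\<^sup>1\<close> is a nominal optimum for every \<open>s\<close>. With weight 1 on
  the first two coordinates, weight 0 on the others and \<open>B = 1\<close>, the adversary can cancel
  everything except one of the first two coordinates, so a vector has positive max-min value iff
  it starts with \<open>True True\<close>. Hence the optimum is positive iff \<open>s \<in> L\<close>, and an approximation
  algorithm with any ratio \<open>\<alpha> > 0\<close> decides \<open>L\<close>.

  The machines needed for this reduction are obtained from structured programs, whose control
  states are continuations. Most of them use each tape as a stack of bits with the head on its top.
\<close>

section \<open>Structured programs on tapes\<close>

text \<open>\<open>Act f\<close> turns the vector of scanned symbols into a symbol and a move for
  every tape. Indexing tapes by all of \<open>nat\<close> avoids lists of fixed length;
  \<open>wf_prog\<close> restricts attention to finitely many tapes.\<close>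

datatype prog =
    Act "(nat \<Rightarrow> nat) \<Rightarrow> nat \<Rightarrow> nat \<times> int"
  | Seq prog prog
  | Switch nat "nat \<Rightarrow> prog"
  | While nat "nat set" prog

text \<open>A small-step semantics on a stack of pending programs. Pure control steps rewrite the
  scanned symbols and do not move, so each call of \<open>advance\<close> matches exactly one
  machine step; the empty stack is a fixed point, like the halting state.\<close>

fun advance :: "prog list \<Rightarrow> (nat \<Rightarrow> nat) \<Rightarrow> prog list \<times> (nat \<Rightarrow> nat \<times> int)" where
  "advance [] v = ([], \<lambda>i. (v i, 0))"
| "advance (Act f # K) v = (K, f v)"
| "advance (Seq p q # K) v = (p # q # K, \<lambda>i. (v i, 0))"
| "advance (Switch j f # K) v = (f (v j) # K, \<lambda>i. (v i, 0))"
| "advance (While j A p # K) v = (if v j \<in> A then p # While j A p # K else K, \<lambda>i. (v i, 0))"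

type_synonym store = "nat \<Rightarrow> tape"

definition pstep :: "prog list \<times> store \<Rightarrow> prog list \<times> store" where
  "pstep c = (let r = advance (fst c) (\<lambda>i. snd c i 0)
     in (fst r, \<lambda>i. act (snd r i) (snd c i)))"

text \<open>These are the conditions for a finite machine: actions on the first \<open>T\<close>
  tapes depend on those tapes only, the alphabet \<open>{..<S}\<close> is preserved, and the finite
  range in \<open>Switch\<close> leaves only finitely many continuations.\<close>

primrec wf_prog :: "nat \<Rightarrow> nat \<Rightarrow> prog \<Rightarrow> bool" where
  "wf_prog T S (Act f) \<longleftrightarrow>
     (\<forall>v v'. (\<forall>i<T. v i = v' i) \<longrightarrow> (\<forall>i<T. f v i = f v' i)) \<and>
     (\<forall>v. (\<forall>i. v i < S) \<longrightarrow> (\<forall>i<T. fst (f v i) < S \<and> snd (f v i) \<in> {-1, 0, 1}))"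
| "wf_prog T S (Seq p q) \<longleftrightarrow> wf_prog T S p \<and> wf_prog T S q"
| "wf_prog T S (Switch j f) \<longleftrightarrow> j < T \<and> finite (range f) \<and> (\<forall>x. wf_prog T S (f x))"
| "wf_prog T S (While j A p) \<longleftrightarrow> j < T \<and> wf_prog T S p"

text \<open>The continuations that arise while \<open>p\<close> is executed in front of \<open>K\<close>; they become the
  control states of the compiled machine.\<close>

primrec conts :: "prog \<Rightarrow> prog list \<Rightarrow> prog list set" where
  "conts (Act f) K = {Act f # K}"
| "conts (Seq p q) K = insert (Seq p q # K) (conts p (q # K) \<union> conts q K)"
| "conts (Switch j f) K = insert (Switch j f # K) (\<Union>x. conts (f x) K)"
| "conts (While j A p) K = insert (While j A p # K) (conts p (While j A p # K))"

section \<open>Compilation of programs into Turing machines\<close>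

lemma start_in_conts: "p # K \<in> conts p K"
  by (cases p) auto

lemma finite_conts: "wf_prog T S p \<Longrightarrow> finite (conts p K)"
proof (induction p arbitrary: K)
  case (Switch j f)
  have "(\<Union>x. conts (f x) K) = (\<Union>q\<in>range f. conts q K)" by blast
  moreover have "finite (\<Union>q\<in>range f. conts q K)"
    using Switch by (intro finite_UN_I) auto
  ultimately show ?case by simp
qed auto

text \<open>Execution of \<open>p\<close> leaves \<open>conts p K\<close> only through
  \<open>K\<close>. With \<open>K = []\<close> this makes the continuations a closed set of control
  states.\<close>

lemma advance_conts: "K1 \<in> conts p K \<Longrightarrow> fst (advance K1 v) \<in> insert K (conts p K)"
proof (induction p arbitrary: K)
  case (Seq p q)
  then show ?case using start_in_conts[of p "q # K"] start_in_conts[of q K] by fastforce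
next
  case (Switch j f)
  then show ?case using start_in_conts[of "f (v j)" K] by fastforce
next
  case (While j A p)
  then show ?case using start_in_conts[of p "While j A p # K"] by fastforce
qed auto

lemma conts_wf: "K1 \<in> conts p K \<Longrightarrow> wf_prog T S p \<Longrightarrow> \<exists>q K2. K1 = q # K2 \<and> wf_prog T S q"
  by (induction p arbitrary: K) fastforce+

lemma advance_wf:
  assumes "wf_prog T S q" "\<forall>i. v i < S" "i < T"
  shows "fst (snd (advance (q # K) v) i) < S \<and> snd (snd (advance (q # K) v) i) \<in> {-1, 0, 1}"
  using assms by (cases q) auto

text \<open>Allows the infinitely many tapes of a store to be replaced by the \<open>T\<close> tapes
  of a machine.\<close>

lemma advance_cong:
  assumes "wf_prog T S q" "\<forall>i<T. v i = v' i"
  shows "fst (advance (q # K) v) = fst (advance (q # K) v')"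
    and "i < T \<Longrightarrow> snd (advance (q # K) v) i = snd (advance (q # K) v') i"
  using assms by (cases q; auto)+

lemma map2_map_upt: "map2 f (map a [0..<T]) (map b [0..<T]) = map (\<lambda>i. f (a i) (b i)) [0..<T]"
  by (auto intro!: nth_equalityI)

lemma act_stay: "act (t 0, 0) t = t"
  by (auto simp: act_def)

text \<open>The control states are numbers for the finitely many continuations. Since every
  \<open>pstep\<close> is one machine step, the step counts agree exactly and no slowdown has to be
  tracked.\<close>

theorem compile_prog:
  assumes wf: "wf_prog T S p" and T: "T \<ge> 1" and S: "S \<ge> 3"
  obtains M where "turing_machine M" "tapes M = T"
    "\<And>n g g'. (pstep ^^ n) ([p], g) = ([], g') \<Longrightarrow>
       (step M ^^ n) (0, map g [0..<T]) = (1, map g' [0..<T])"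
proof -
  define C where "C = insert [] (conts p [])"
  have finC: "finite C" using finite_conts[OF wf] by (simp add: C_def)
  then obtain h where h: "bij_betw h C {..<card C}"
    using ex_bij_betw_finite_nat by (metis lessThan_atLeast0)
  \<comment> \<open>The machine model fixes state 0 as initial and state 1 as halting, so
    \<open>[p]\<close> and \<open>[]\<close> get these numbers and all other continuations are
    shifted by 2.\<close>
  define e where "e K = (if K = [] then 1 else if K = [p] then 0 else h K + 2)" for K
  have inje: "inj_on e C"
    using h by (auto simp: inj_on_def bij_betw_def e_def)
  have eb: "e K < card C + 2" if "K \<in> C" for K
    using h that by (auto simp: bij_betw_def e_def)
  \<comment> \<open>Numbers that code no continuation are read as \<open>[]\<close>, which keeps the
    transition function total and inside \<open>C\<close>.\<close>
  define dec where "dec q = (if q \<in> e ` C then inv_into C e q else [])" for q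
  have dece: "dec (e K) = K" if "K \<in> C" for K
    using that inje by (simp add: dec_def)
  have decC: "dec q \<in> C" for q
    by (metis C_def dec_def insertI1 inv_into_into)
  have adv: "fst (advance K v) \<in> C" if "K \<in> C" for K v
    using that advance_conts[of K p "[]"] by (auto simp: C_def)
  define view where "view ss = (\<lambda>i. if i < T then ss ! i else 0)" for ss :: "nat list"
  define M where "M = \<lparr>tapes = T, states = card C + 2, symbols = S,
    delta = \<lambda>q ss. (e (fst (advance (dec q) (view ss))),
                     map (snd (advance (dec q) (view ss))) [0..<T])\<rparr>"
  have "turing_machine M"
    unfolding turing_machine_def
  proof (intro conjI allI impI)
    fix q ss assume a: "q < states M \<and> length ss = tapes M \<and> set ss \<subseteq> {..<symbols M}"
    have v: "\<forall>i. view ss i < S"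
    proof
      fix i show "view ss i < S"
        using a S by (auto simp: view_def M_def dest: nth_mem)
    qed
    show "fst (delta M q ss) < states M"
      using eb[OF adv[OF decC]] by (simp add: M_def)
    show "length (snd (delta M q ss)) = tapes M"
      by (simp add: M_def)
    have "snd (advance (dec q) (view ss)) i \<in> {..<S} \<times> {-1, 0, 1}" if "i < T" for i
    proof (cases "dec q = []")
      case True
      then show ?thesis using v by simp
    next
      case False
      then obtain q' K' where "dec q = q' # K'" "wf_prog T S q'"
        using conts_wf[OF _ wf, of "dec q" "[]"] decC[of q] by (auto simp: C_def)
      then show ?thesis using advance_wf[of T S q' "view ss" i K'] v that
        by (metis lessThan_iff mem_Sigma_iff prod.collapse)
    qed
    then show "set (snd (delta M q ss)) \<subseteq> {..<symbols M} \<times> {- 1, 0, 1}"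
      by (simp add: M_def image_subset_iff)
  qed (use T S in \<open>auto simp: M_def\<close>)
  define code where "code c = (e (fst c), map (snd c) [0..<T])" for c :: "prog list \<times> store"
  have sim: "step M (code c) = code (pstep c)" if c: "fst c \<in> C" for c
  proof (cases "fst c = []")
    case True
    then show ?thesis by (simp add: step_def code_def e_def pstep_def act_stay)
  next
    case False
    then obtain q K where qK: "fst c = q # K" "wf_prog T S q"
      using conts_wf[OF _ wf, of "fst c" "[]"] c by (auto simp: C_def)
    let ?v = "\<lambda>i. snd c i 0"
    let ?v' = "view (map (\<lambda>t. t 0) (map (snd c) [0..<T]))"
    have v: "\<forall>i<T. ?v i = ?v' i" by (simp add: view_def)
    note cong = advance_cong(1)[OF qK(2) v, of K, folded qK(1)]
      advance_cong(2)[OF qK(2) v, where K = K, folded qK(1)]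
    have "e (fst c) \<noteq> 1" using False by (simp add: e_def)
    then have "step M (code c) = (e (fst (advance (fst c) ?v')),
        map (\<lambda>i. act (snd (advance (fst c) ?v') i) (snd c i)) [0..<T])"
      by (simp add: step_def code_def Let_def M_def dece[OF c] map2_map_upt)
    also have "\<dots> = code (pstep c)"
      using cong by (simp add: code_def pstep_def Let_def)
    finally show ?thesis .
  qed
  have inv: "fst ((pstep ^^ n) c) \<in> C \<and> (step M ^^ n) (code c) = code ((pstep ^^ n) c)"
    if "fst c \<in> C" for n c
  proof (induction n)
    case (Suc n)
    then show ?case using sim adv by (simp add: pstep_def Let_def)
  qed (use that in simp)
  have "(step M ^^ n) (0, map g [0..<T]) = (1, map g' [0..<T])"
    if "(pstep ^^ n) ([p], g) = ([], g')" for n g g'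
    using inv[of "([p], g)" n] that start_in_conts[of p "[]"]
    by (simp add: code_def e_def C_def)
  then show thesis
    using that \<open>turing_machine M\<close> by (simp add: M_def)
qed

section \<open>Executions with time bounds\<close>

text \<open>Quantifying over the continuation \<open>K\<close> makes runs compose. The bound
  \<open>n\<close> is only an upper bound, so branches of different cost can share one
  estimate.\<close>

definition runs :: "prog \<Rightarrow> store \<Rightarrow> nat \<Rightarrow> store \<Rightarrow> bool" where
  "runs p g n g' \<longleftrightarrow> (\<forall>K. \<exists>m\<le>n. (pstep ^^ m) (p # K, g) = (K, g'))"

lemma runs_mono: "runs p g n g' \<Longrightarrow> n \<le> n' \<Longrightarrow> runs p g n' g'"
  unfolding runs_def by (meson order_trans)

lemma funpow_trans: "(f ^^ m) x = y \<Longrightarrow> (f ^^ n) y = z \<Longrightarrow> (f ^^ (m + n)) x = z"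
  by (metis add.commute comp_apply funpow_add)

lemma runs_step:
  assumes "\<And>K. pstep (p # K, g) = (q # K, g)" "runs q g n g'"
  shows "runs p g (Suc n) g'"
  unfolding runs_def
proof
  fix K
  obtain m where "m \<le> n" "(pstep ^^ m) (q # K, g) = (K, g')"
    using assms(2) unfolding runs_def by blast
  then show "\<exists>m\<le>Suc n. (pstep ^^ m) (p # K, g) = (K, g')"
    using assms(1) by (intro exI[of _ "Suc m"]) (simp del: funpow.simps add: funpow_Suc_right)
qed

text \<open>The common pattern of \<open>Seq\<close> and of one loop iteration: a control step puts
  two programs in front of the continuation, and \<open>Suc\<close> pays for that step. The first
  run is used with the continuation \<open>q' # K\<close>.\<close>

lemma runs_chain:
  assumes "\<And>K. pstep (p # K, g) = (q # q' # K, g)" "runs q g n g'" "runs q' g' n' g''"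
  shows "runs p g (Suc (n + n')) g''"
  unfolding runs_def
proof
  fix K
  obtain m where m: "m \<le> n" "(pstep ^^ m) (q # q' # K, g) = (q' # K, g')"
    using assms(2) unfolding runs_def by blast
  obtain m' where m': "m' \<le> n'" "(pstep ^^ m') (q' # K, g') = (K, g'')"
    using assms(3) unfolding runs_def by blast
  have "(pstep ^^ Suc (m + m')) (p # K, g) = (K, g'')"
    using funpow_trans[OF m(2) m'(2)] assms(1)
    by (simp del: funpow.simps add: funpow_Suc_right)
  then show "\<exists>m\<le>Suc (n + n'). (pstep ^^ m) (p # K, g) = (K, g'')"
    using m(1) m'(1) by (intro exI[of _ "Suc (m + m')"]) auto
qed

lemma runs_Act: "runs (Act f) g 1 (\<lambda>i. act (f (\<lambda>j. g j 0) i) (g i))"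
  by (auto simp: runs_def pstep_def intro!: exI[of _ 1])

lemma runs_Seq: "runs p g n g' \<Longrightarrow> runs q g' n' g'' \<Longrightarrow> runs (Seq p q) g (Suc (n + n')) g''"
  by (rule runs_chain) (auto simp: pstep_def act_stay)

lemma runs_Switch: "runs (f (g j 0)) g n g' \<Longrightarrow> runs (Switch j f) g (Suc n) g'"
  by (rule runs_step) (auto simp: pstep_def act_stay)

lemma runs_While_stop: "g j 0 \<notin> A \<Longrightarrow> runs (While j A p) g 1 g"
  by (auto simp: runs_def pstep_def act_stay intro!: exI[of _ 1])

lemma runs_While_loop:
  "g j 0 \<in> A \<Longrightarrow> runs p g n g' \<Longrightarrow> runs (While j A p) g' n' g'' \<Longrightarrow>
   runs (While j A p) g (Suc (n + n')) g''"
  by (rule runs_chain[of "While j A p" g p "While j A p"]) (auto simp: pstep_def act_stay)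

section \<open>Polynomial bounds and stack programs\<close>

definition bank :: "(nat \<Rightarrow> bool list) \<Rightarrow> store" where
  "bank r = (\<lambda>i. input_tape (r i))"

definition start :: "bool list \<Rightarrow> nat \<Rightarrow> bool list" where
  "start x = (\<lambda>_. [])(0 := x)"

text \<open>The output convention for a single tape. In contrast to \<open>input_tape\<close>,
  nothing is said about cells outside the block, since a machine may leave garbage there.\<close>

definition carries :: "tape \<Rightarrow> bool list \<Rightarrow> bool" where
  "carries t y \<longleftrightarrow> (\<forall>i<length y. t (int i) = bit_symbol (y ! i)) \<and> t (int (length y)) = 0"

text \<open>The base \<open>n + 1\<close> is at least 1, so powers grow with the exponent even at
  \<open>n = 0\<close>; closure under sums and products then needs no case distinction.\<close>

definition poly_bounded :: "(nat \<Rightarrow> nat) \<Rightarrow> bool" where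
  "poly_bounded f \<longleftrightarrow> (\<exists>c k. \<forall>n. f n \<le> c * (n + 1) ^ k)"

lemma poly_bounded_const: "poly_bounded (\<lambda>_. c)"
  unfolding poly_bounded_def by (rule exI[of _ c], rule exI[of _ 0]) simp

lemma poly_bounded_id: "poly_bounded (\<lambda>n. n)"
  unfolding poly_bounded_def by (rule exI[of _ 1], rule exI[of _ 1]) simp

lemma poly_bounded_add:
  assumes "poly_bounded f" "poly_bounded g"
  shows "poly_bounded (\<lambda>n. f n + g n)"
proof -
  obtain c k d l where f: "\<And>n. f n \<le> c * (n + 1) ^ k" and g: "\<And>n. g n \<le> d * (n + 1) ^ l"
    using assms unfolding poly_bounded_def by blast
  have "f n + g n \<le> (c + d) * (n + 1) ^ (k + l)" for n
  proof -
    have "(n + 1) ^ k \<le> (n + 1) ^ (k + l)" "(n + 1) ^ l \<le> (n + 1) ^ (k + l)"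
      by (intro power_increasing; simp)+
    then have "c * (n + 1) ^ k + d * (n + 1) ^ l \<le> (c + d) * (n + 1) ^ (k + l)"
      by (simp add: add_mult_distrib add_mono del: power_add)
    then show ?thesis using f[of n] g[of n] by linarith
  qed
  then show ?thesis unfolding poly_bounded_def by blast
qed

lemma poly_bounded_mult:
  assumes "poly_bounded f" "poly_bounded g"
  shows "poly_bounded (\<lambda>n. f n * g n)"
proof -
  obtain c k d l where f: "\<And>n. f n \<le> c * (n + 1) ^ k" and g: "\<And>n. g n \<le> d * (n + 1) ^ l"
    using assms unfolding poly_bounded_def by blast
  have "f n * g n \<le> (c * d) * (n + 1) ^ (k + l)" for n
    using mult_mono[OF f[of n] g[of n]] by (simp add: power_add ac_simps)
  then show ?thesis unfolding poly_bounded_def by blast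
qed

lemma poly_bounded_power: "poly_bounded f \<Longrightarrow> poly_bounded (\<lambda>n. f n ^ k)"
  by (induction k) (auto intro: poly_bounded_const poly_bounded_mult)

lemmas poly_bounded_intros =
  poly_bounded_const poly_bounded_id poly_bounded_add poly_bounded_mult poly_bounded_power

text \<open>Gives the shape required by \<open>polytime_solvable\<close>. For
  \<open>n \<ge> 1\<close> it uses \<open>n + 1 \<le> 2 * n\<close>, whence the factor
  \<open>2 ^ k\<close>; the additive constant takes care of \<open>n = 0\<close>.\<close>

lemma poly_bounded_normal_form:
  assumes "poly_bounded f"
  obtains a k where "\<And>n. f n \<le> a * n ^ k + a"
proof -
  obtain c k where f: "\<And>n. f n \<le> c * (n + 1) ^ k"
    using assms unfolding poly_bounded_def by blast
  have "f n \<le> (c * 2 ^ k) * n ^ k + c * 2 ^ k" for n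
  proof (cases "n = 0")
    case True
    have "c \<le> c * 2 ^ k" by simp
    moreover have "f 0 \<le> c" using f[of 0] by simp
    ultimately have "f 0 \<le> c * 2 ^ k" by (rule order_trans[rotated])
    then show ?thesis using True by simp
  next
    case False
    then have "(n + 1) ^ k \<le> (2 * n) ^ k" by (intro power_mono) auto
    then have "c * (n + 1) ^ k \<le> c * 2 ^ k * n ^ k"
      by (simp add: power_mult_distrib mult.assoc)
    then show ?thesis using f[of n] by linarith
  qed
  then show thesis using that by blast
qed

section \<open>From program runs to polynomial-time solvability\<close>

lemma step_halted: "fst c = 1 \<Longrightarrow> (step M ^^ n) c = c"
  by (induction n) (auto simp: step_def)

lemma step_halted_mono:
  assumes "fst ((step M ^^ m) c) = 1" "m \<le> n"
  shows "(step M ^^ n) c = (step M ^^ m) c"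
proof -
  obtain d where "n = d + m" using assms(2) le_Suc_ex by (metis add.commute)
  then show ?thesis by (simp add: funpow_add step_halted[OF assms(1)])
qed

text \<open>Halting configurations are fixed by \<open>step\<close>, so evaluating at exactly
  \<open>t\<close> steps is the same as halting within \<open>t\<close> steps.\<close>

lemma computes_within_mono: "computes_within M x y m \<Longrightarrow> m \<le> n \<Longrightarrow> computes_within M x y n"
  by (simp add: computes_within_def step_halted_mono[where m = m and n = n])

lemma initial_bank:
  assumes "tapes M = T" "T \<ge> 1"
  shows "initial M x = (0, map (bank (start x)) [0..<T])"
proof -
  have "map (bank (start x)) [0..<T] = input_tape x # replicate (T - 1) (\<lambda>_. 0)"
    using assms(2)
    by (intro nth_equalityI)
       (auto simp: bank_def start_def nth_Cons input_tape_def split: nat.split)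
  then show ?thesis by (simp add: initial_def assms(1))
qed

text \<open>The interface to the machine model: from here on a problem is solved by exhibiting a
  program that finds its input on tape 0, leaves its answer there, and has a polynomial bound on its
  running time.\<close>

lemma polytime_solvable_store:
  assumes wf: "wf_prog T S p" and T: "T \<ge> 1" and S: "S \<ge> 3" and t: "poly_bounded t"
    and run: "\<And>i. i \<in> I \<Longrightarrow>
      \<exists>g y. runs p (bank (start (enc i))) (t (length (enc i))) g \<and> carries (g 0) y \<and> R i y"
  shows "polytime_solvable enc I R"
proof -
  obtain M where M: "turing_machine M" "tapes M = T" and sim:
    "\<And>n g g'. (pstep ^^ n) ([p], g) = ([], g') \<Longrightarrow>
       (step M ^^ n) (0, map g [0..<T]) = (1, map g' [0..<T])"
    using compile_prog[OF wf T S] by blast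
  obtain a k where ak: "\<And>n. t n \<le> a * n ^ k + a"
    using poly_bounded_normal_form[OF t] by blast
  have "\<exists>y. R i y \<and> computes_within M (enc i) y (a * length (enc i) ^ k + a)" if "i \<in> I" for i
  proof -
    obtain g y where g: "runs p (bank (start (enc i))) (t (length (enc i))) g"
      "carries (g 0) y" "R i y"
      using run[OF \<open>i \<in> I\<close>] by blast
    then obtain m where m: "m \<le> t (length (enc i))"
      "(pstep ^^ m) ([p], bank (start (enc i))) = ([], g)"
      unfolding runs_def by blast
    have "(step M ^^ m) (initial M (enc i)) = (1, map g [0..<T])"
      using sim[OF m(2)] by (simp add: initial_bank[OF M(2) T])
    then have "computes_within M (enc i) y m"
      using g(2) T by (simp add: computes_within_def output_is_def carries_def upt_rec[of 0 T])
    then show ?thesis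
      using g(3) computes_within_mono m(1) ak order_trans by blast
  qed
  then show ?thesis using M(1) unfolding polytime_solvable_def by blast
qed

text \<open>Popping erases the cell it leaves, so that a stack \<open>xs\<close> is always exactly the tape
  \<open>input_tape xs\<close>, with blanks on both sides.\<close>

definition pop :: "nat \<Rightarrow> prog" where
  "pop j = Act (\<lambda>v i. if i = j then (0, 1) else (v i, 0))"

text \<open>An action writes before it moves, so pushing takes two actions: first go left, then
  write.\<close>

definition push :: "nat \<Rightarrow> bool \<Rightarrow> prog" where
  "push j b = Seq (Act (\<lambda>v i. (v i, if i = j then -1 else 0)))
     (Act (\<lambda>v i. (if i = j then bit_symbol b else v i, 0)))"

definition branch :: "nat \<Rightarrow> prog \<Rightarrow> prog \<Rightarrow> prog \<Rightarrow> prog" where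
  "branch j p0 pF pT = Switch j (\<lambda>x. if x = 0 then p0 else if x = 1 then pF else pT)"

text \<open>Consumes a stack and runs \<open>p\<close> on every popped bit. The branch passes the
  bit to \<open>p\<close> through the control state; its blank case is excluded by the loop
  test.\<close>

definition each :: "nat \<Rightarrow> (bool \<Rightarrow> prog) \<Rightarrow> prog" where
  "each j p = While j (- {0})
     (branch j (pop j) (Seq (pop j) (p False)) (Seq (pop j) (p True)))"

definition while_true :: "nat \<Rightarrow> prog \<Rightarrow> prog" where
  "while_true j p = While j {2} (Seq (pop j) p)"

abbreviation move :: "nat \<Rightarrow> nat \<Rightarrow> prog" where
  "move i j \<equiv> each i (push j)"

section \<open>Well-formedness and running times of stack programs\<close>

lemma wf_pop [simp]: "3 \<le> S \<Longrightarrow> wf_prog T S (pop j)"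
  by (auto simp: pop_def)

lemma wf_push [simp]: "3 \<le> S \<Longrightarrow> wf_prog T S (push j b)"
  by (auto simp: push_def bit_symbol_def)

lemma wf_branch [simp]:
  assumes "j < T" "wf_prog T S p0" "wf_prog T S pF" "wf_prog T S pT"
  shows "wf_prog T S (branch j p0 pF pT)"
proof -
  have "range (\<lambda>x::nat. if x = 0 then p0 else if x = 1 then pF else pT) \<subseteq> {p0, pF, pT}"
    by auto
  then have "finite (range (\<lambda>x::nat. if x = 0 then p0 else if x = 1 then pF else pT))"
    using finite_subset by blast
  then show ?thesis using assms by (simp add: branch_def)
qed

lemma wf_each [simp]: "3 \<le> S \<Longrightarrow> j < T \<Longrightarrow> (\<And>b. wf_prog T S (p b)) \<Longrightarrow> wf_prog T S (each j p)"
  by (simp add: each_def)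

lemma wf_while_true [simp]: "3 \<le> S \<Longrightarrow> j < T \<Longrightarrow> wf_prog T S p \<Longrightarrow> wf_prog T S (while_true j p)"
  by (simp add: while_true_def)

abbreviation srun :: "prog \<Rightarrow> (nat \<Rightarrow> bool list) \<Rightarrow> nat \<Rightarrow> (nat \<Rightarrow> bool list) \<Rightarrow> bool" where
  "srun p r n r' \<equiv> runs p (bank r) n (bank r')"

lemma bank_upd: "bank (r(j := xs)) = (bank r)(j := input_tape xs)"
  by (auto simp: bank_def)

lemma input_tape_0: "input_tape xs 0 = (case xs of [] \<Rightarrow> 0 | b # _ \<Rightarrow> bit_symbol b)"
  by (auto simp: input_tape_def split: list.split)

lemma bit_symbol_simps [simp]:
  "bit_symbol True = 2" "bit_symbol False = 1" "bit_symbol b \<noteq> 0" "bit_symbol b = 2 \<longleftrightarrow> b"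
  "bit_symbol b = Suc 0 \<longleftrightarrow> \<not> b"
  by (auto simp: bit_symbol_def)

lemma act_pop: "act (0, 1) (input_tape xs) = input_tape (tl xs)"
  by (cases xs) (auto simp: act_def input_tape_def fun_eq_iff nth_Cons' nat_add_distrib)

lemma act_push: "act (bit_symbol b, 0) (act (input_tape xs 0, -1) (input_tape xs)) = input_tape (b # xs)"
  by (auto simp: act_def input_tape_def fun_eq_iff nth_Cons' nat_diff_distrib)

lemma srun_weaken: "srun p r n r1 \<Longrightarrow> r1 = r' \<Longrightarrow> n \<le> n' \<Longrightarrow> srun p r n' r'"
  using runs_mono by blast

lemma runs_pop: "runs (pop j) g 1 (g(j := act (0, 1) (g j)))"
proof -
  have "(\<lambda>i. act (if i = j then (0, 1) else (g i 0, 0)) (g i)) = g(j := act (0, 1) (g j))"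
    by (auto simp: act_stay)
  then show ?thesis using runs_Act[of "\<lambda>v i. if i = j then (0, 1) else (v i, 0)" g] by (simp add: pop_def)
qed

lemma runs_push:
  assumes "g j = input_tape xs"
  shows "runs (push j b) g 3 (g(j := input_tape (b # xs)))"
proof -
  let ?g = "\<lambda>i. act (g i 0, if i = j then -1 else 0) (g i)"
  have 1: "runs (Act (\<lambda>v i. (v i, if i = j then -1 else 0))) g 1 ?g"
    using runs_Act[of "\<lambda>v i. (v i, if i = j then -1 else 0)" g] by simp
  have "(\<lambda>i. act (if i = j then bit_symbol b else ?g i 0, 0) (?g i)) = g(j := input_tape (b # xs))"
    using act_push[of b xs] assms by (auto simp: act_stay)
  then have 2: "runs (Act (\<lambda>v i. (if i = j then bit_symbol b else v i, 0))) ?g 1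
      (g(j := input_tape (b # xs)))"
    using runs_Act[of "\<lambda>v i. (if i = j then bit_symbol b else v i, 0)" ?g] by simp
  show ?thesis using runs_Seq[OF 1 2] by (simp add: push_def numeral_3_eq_3)
qed

lemma srun_pop: "srun (pop j) r 1 (r(j := tl (r j)))"
  using runs_pop[of j "bank r"] by (simp add: bank_upd) (simp add: bank_def act_pop)

lemma srun_push: "srun (push j b) r 3 (r(j := b # r j))"
  using runs_push[of "bank r" j "r j" b] by (simp add: bank_upd) (simp add: bank_def)

lemma srun_branch:
  assumes "srun (case r j of [] \<Rightarrow> p0 | b # _ \<Rightarrow> if b then pT else pF) r n r'"
  shows "srun (branch j p0 pF pT) r (Suc n) r'"
  unfolding branch_def using assms
  by (intro runs_Switch) (auto simp: bank_def input_tape_0 split: list.splits if_splits)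

text \<open>Loop rule with invariant \<open>R ys xs\<close>: \<open>ys\<close> are the bits already
  consumed, latest first, and \<open>xs\<close> those still on the stack. Each round costs 4 beyond
  the body, for the loop test, the branch, the sequencing and the pop.\<close>

lemma srun_each:
  assumes top: "\<And>ys xs. R ys xs j = xs"
    and body: "\<And>ys b xs. srun (p b) ((R ys (b # xs))(j := xs)) c (R (b # ys) xs)"
  shows "srun (each j p) (R ys xs) ((c + 4) * length xs + 1) (R (rev xs @ ys) [])"
proof (induction xs arbitrary: ys)
  case Nil
  show ?case
    unfolding each_def using runs_While_stop[of "bank (R ys [])" j]
    by (simp add: bank_def top input_tape_0)
next
  case (Cons b xs)
  let ?r = "R ys (b # xs)"
  have "srun (Seq (pop j) (p b)) ?r (Suc (1 + c)) (R (b # ys) xs)"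
    using srun_pop[of j ?r] body[of b ys xs] by (intro runs_Seq) (simp_all add: top)
  then have "srun (branch j (pop j) (Seq (pop j) (p False)) (Seq (pop j) (p True)))
      ?r (Suc (Suc (1 + c))) (R (b # ys) xs)"
    by (intro srun_branch) (auto simp: top)
  then have "srun (each j p) ?r (Suc (Suc (Suc (1 + c)) + ((c + 4) * length xs + 1)))
      (R (rev xs @ b # ys) [])"
    unfolding each_def
    by (intro runs_While_loop[OF _ _ Cons.IH[unfolded each_def]])
       (auto simp: bank_def top input_tape_0)
  then show ?case by (auto elim: runs_mono)
qed

lemma srun_while_true_stop:
  "\<not> (\<exists>xs. r j = True # xs) \<Longrightarrow> srun (while_true j p) r 1 r"
  unfolding while_true_def
  by (intro runs_While_stop, cases "r j") (auto simp: bank_def input_tape_0)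

lemma srun_while_true_loop:
  assumes "r j = True # xs" "srun p (r(j := xs)) n r'" "srun (while_true j p) r' n' r''"
  shows "srun (while_true j p) r (n + n' + 3) r''"
proof -
  have "srun (Seq (pop j) p) r (Suc (1 + n)) r'"
    using srun_pop[of j r] assms(1,2) by (intro runs_Seq) simp_all
  then have "srun (while_true j p) r (Suc (Suc (1 + n) + n')) r''"
    unfolding while_true_def using assms(1,3)
    by (intro runs_While_loop) (auto simp: bank_def input_tape_0 while_true_def)
  then show ?thesis by (auto elim: runs_mono)
qed

text \<open>Loop rule for a unary counter on top of a stack: in \<open>R k m\<close>,
  \<open>k\<close> units are consumed and \<open>m\<close> remain. The loop stops at
  \<open>zs\<close> because \<open>zs\<close> does not begin with \<open>True\<close>.\<close>

lemma srun_while_true: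
  assumes top: "\<And>k m. R k m j = replicate m True @ zs" "\<not> (\<exists>xs. zs = True # xs)"
    and body: "\<And>k m. srun p ((R k (Suc m))(j := replicate m True @ zs)) c (R (Suc k) m)"
  shows "srun (while_true j p) (R k m) ((c + 3) * m + 1) (R (k + m) 0)"
proof (induction m arbitrary: k)
  case 0
  then show ?case using top srun_while_true_stop[of "R k 0" j] by simp
next
  case (Suc m)
  show ?case
    using srun_while_true_loop[OF _ body Suc[of "Suc k"]] top(1) by (auto elim: runs_mono)
qed

lemma srun_move:
  assumes "i \<noteq> j"
  shows "srun (move i j) r (7 * length (r i) + 1) (r(i := [], j := rev (r i) @ r j))"
proof -
  have "srun (push j b) ((r(i := b # xs, j := ys @ r j))(i := xs)) 3 (r(i := xs, j := (b # ys) @ r j))"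
    for b xs ys
    using srun_push[of j b "r(i := xs, j := ys @ r j)"] assms by (simp add: fun_upd_twist)
  then show ?thesis
    using srun_each[of "\<lambda>ys xs. r(i := xs, j := ys @ r j)" i "push j" 3 "[]" "r i"] assms by simp
qed

lemma carries_input_tape: "carries (input_tape y) y"
  by (simp add: carries_def input_tape_def)

lemma carries_pop: "carries t (b # xs) \<Longrightarrow> carries (act (0, 1) t) xs"
  by (auto simp: carries_def act_def add.commute dest: spec[of _ "Suc _"])

text \<open>The version of \<open>srun_move\<close> for the output of a called machine. The source
  tape may hold garbage behind the block, so its final content \<open>t\<close> stays unspecified,
  while the target is a clean stack.\<close>

lemma runs_move:
  assumes "i \<noteq> j" "carries (g i) xs" "g j = input_tape ys"
  shows "\<exists>t. runs (move i j) g (7 * length xs + 1) (g(i := t, j := input_tape (rev xs @ ys)))"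
  using assms(2,3)
proof (induction xs arbitrary: ys g)
  case Nil
  then have "runs (move i j) g 1 g"
    unfolding each_def by (intro runs_While_stop) (simp add: carries_def)
  moreover have "g(i := g i, j := input_tape ys) = g" using Nil by auto
  ultimately show ?case by (intro exI[of _ "g i"]) simp
next
  case (Cons b xs)
  let ?t = "act (0, 1) (g i)"
  let ?g = "g(i := ?t, j := input_tape (b # ys))"
  have b: "g i 0 = bit_symbol b" using Cons.prems(1) by (auto simp: carries_def)
  have "runs (push j b) (g(i := ?t)) 3 ?g"
    using Cons.prems(2) assms(1) by (intro runs_push) simp
  from runs_Seq[OF runs_pop this] have "runs (Seq (pop i) (push j b)) g 5 ?g" by simp
  then have 1: "runs (branch i (pop i) (Seq (pop i) (push j False)) (Seq (pop i) (push j True))) g 6 ?g"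
    unfolding branch_def using runs_Switch[where n = 5 and j = i and g = g] b
    by (cases b) auto
  have "carries (?g i) xs" "?g j = input_tape (b # ys)"
    using carries_pop[OF Cons.prems(1)] assms(1) by auto
  from Cons.IH[OF this] obtain t where "runs (move i j) ?g (7 * length xs + 1)
      (?g(i := t, j := input_tape (rev xs @ b # ys)))" by blast
  from runs_While_loop[OF _ 1 this[unfolded each_def]]
  have "runs (move i j) g (Suc (6 + (7 * length xs + 1)))
      (?g(i := t, j := input_tape (rev xs @ b # ys)))"
    using b unfolding each_def by simp
  moreover have "?g(i := t, j := input_tape (rev xs @ b # ys)) =
      g(i := t, j := input_tape (rev (b # xs) @ ys))"
    using assms(1) by (simp add: fun_upd_twist)
  moreover have "Suc (6 + (7 * length xs + 1)) = 7 * length (b # xs) + 1" by simp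
  ultimately show ?case by metis
qed

section \<open>Calling a machine as a subroutine\<close>

definition cell :: "nat \<Rightarrow> tape" where
  "cell q = (\<lambda>i. if i = 0 then q else 0)"

text \<open>The control state of the called machine is kept as a symbol on an extra tape; a blank
  there is already its initial state.\<close>

definition call :: "tm \<Rightarrow> nat \<Rightarrow> prog" where
  "call M k = While (k + tapes M) {q. q \<noteq> 1} (Act (\<lambda>v i.
     let q = v (k + tapes M); ss = map v [k..<k + tapes M] in
     if q < states M \<and> set ss \<subseteq> {..<symbols M} then
       if i = k + tapes M then (fst (delta M q ss), 0)
       else if k \<le> i \<and> i < k + tapes M then snd (delta M q ss) ! (i - k)
       else (v i, 0)
     else (v i, 0)))"

section \<open>Invariants of machine runs\<close>

lemma delta_range:
  assumes "turing_machine M" "q < states M" "length ss = tapes M" "set ss \<subseteq> {..<symbols M}"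
  shows "fst (delta M q ss) < states M" "length (snd (delta M q ss)) = tapes M"
    "set (snd (delta M q ss)) \<subseteq> {..<symbols M} \<times> {-1, 0, 1}"
  using assms unfolding turing_machine_def by blast+

text \<open>Serves two purposes: the range conditions satisfy the guard in \<open>call\<close>, and
  the blank region to the right of \<open>N\<close> bounds the length of the output.\<close>

definition bounded_config :: "tm \<Rightarrow> nat \<Rightarrow> config \<Rightarrow> bool" where
  "bounded_config M N c \<longleftrightarrow> fst c < states M \<and> length (snd c) = tapes M \<and>
     (\<forall>t\<in>set (snd c). (\<forall>i. t i < symbols M) \<and> (\<forall>i\<ge>int N. t i = 0))"

lemma bounded_initial:
  assumes "turing_machine M"
  shows "bounded_config M (Suc (length x)) (initial M x)"
  using assms by (auto simp: bounded_config_def initial_def turing_machine_def input_tape_def bit_symbol_def)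

text \<open>One move shifts the contents by at most one cell. The condition \<open>N \<ge> 1\<close>
  covers a symbol written at cell 0 and then shifted to cell 1.\<close>

lemma bounded_step:
  assumes M: "turing_machine M" and c: "bounded_config M N c" and N: "N \<ge> 1"
  shows "bounded_config M (Suc N) (step M c)"
proof (cases "fst c = 1")
  case True
  then show ?thesis using c by (auto simp: step_def bounded_config_def)
next
  case False
  let ?ss = "map (\<lambda>t. t 0) (snd c)"
  let ?d = "delta M (fst c) ?ss"
  have d: "fst ?d < states M" "length (snd ?d) = tapes M"
    "set (snd ?d) \<subseteq> {..<symbols M} \<times> {-1, 0, 1}"
    using c by (intro delta_range[OF M]; auto simp: bounded_config_def)+
  have "(\<forall>i. act a t i < symbols M) \<and> (\<forall>i\<ge>int (Suc N). act a t i = 0)"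
    if "a \<in> set (snd ?d)" "t \<in> set (snd c)" for a t
  proof -
    have "fst a < symbols M" "snd a \<in> {-1, 0, 1}" using d(3) that(1) by auto
    moreover have "\<forall>i. t i < symbols M" "\<forall>i\<ge>int N. t i = 0"
      using c that(2) by (auto simp: bounded_config_def)
    ultimately show ?thesis using N by (auto simp: act_def)
  qed
  then have "\<forall>t\<in>set (map2 act (snd ?d) (snd c)).
      (\<forall>i. t i < symbols M) \<and> (\<forall>i\<ge>int (Suc N). t i = 0)"
    by (fastforce elim!: in_set_zipE)
  moreover have "step M c = (fst ?d, map2 act (snd ?d) (snd c))"
    using False by (simp add: step_def Let_def)
  ultimately show ?thesis
    using d(1,2) c by (simp add: bounded_config_def)
qed

lemma bounded_run:
  assumes "turing_machine M"
  shows "bounded_config M (Suc (length x) + n) ((step M ^^ n) (initial M x))"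
proof (induction n)
  case 0
  then show ?case using bounded_initial[OF assms] by simp
next
  case (Suc n)
  then show ?case using bounded_step[OF assms Suc] by simp
qed

text \<open>A longer output would need a bit in a cell that is still blank after \<open>n\<close>
  steps. This is what keeps a second computation on \<open>y\<close> polynomial.\<close>

lemma output_length:
  assumes M: "turing_machine M" and out: "computes_within M x y n"
  shows "length y \<le> length x + n + 1"
proof (rule ccontr)
  assume *: "\<not> length y \<le> length x + n + 1"
  let ?t = "hd (snd ((step M ^^ n) (initial M x)))"
  have "?t \<in> set (snd ((step M ^^ n) (initial M x)))"
    using bounded_run[OF M, of x n] M by (intro hd_in_set) (auto simp: bounded_config_def turing_machine_def)
  then have "?t (int (length x + n + 1)) = 0"
    using bounded_run[OF M, of x n] by (auto simp: bounded_config_def)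
  moreover have "?t (int (length x + n + 1)) = bit_symbol (y ! (length x + n + 1))"
    using out * unfolding computes_within_def output_is_def by (metis not_le)
  ultimately show False by simp
qed

lemma wf_call:
  assumes M: "turing_machine M" and T: "k + tapes M < T" and S: "states M \<le> S" "symbols M \<le> S"
  shows "wf_prog T S (call M k)"
proof -
  let ?f = "\<lambda>v i.
     let q = v (k + tapes M); ss = map v [k..<k + tapes M] in
     if q < states M \<and> set ss \<subseteq> {..<symbols M} then
       if i = k + tapes M then (fst (delta M q ss), 0)
       else if k \<le> i \<and> i < k + tapes M then snd (delta M q ss) ! (i - k)
       else (v i, 0)
     else (v i, 0 :: int)"
  have "\<forall>i<T. ?f v i = ?f v' i" if "\<forall>i<T. v i = v' i" for v v'
  proof -
    have 1: "map v [k..<k + tapes M] = map v' [k..<k + tapes M]" using that T by auto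
    have 2: "v (k + tapes M) = v' (k + tapes M)" using that T by simp
    show ?thesis unfolding 1 2 using that by (simp add: Let_def)
  qed
  \<comment> \<open>Well-formedness concerns all vectors over the alphabet, also those that are no
    legal view of \<open>M\<close>; there the guard fails and the action changes nothing.\<close>
  moreover have "fst (?f v i) < S \<and> snd (?f v i) \<in> {-1, 0, 1}" if v: "\<forall>i. v i < S" for v i
  proof (cases "v (k + tapes M) < states M \<and> set (map v [k..<k + tapes M]) \<subseteq> {..<symbols M}")
    case True
    let ?d = "delta M (v (k + tapes M)) (map v [k..<k + tapes M])"
    have d: "fst ?d < states M" "length (snd ?d) = tapes M"
      "set (snd ?d) \<subseteq> {..<symbols M} \<times> {-1, 0, 1}"
      using True by (intro delta_range[OF M]; simp)+
    have "snd ?d ! (i - k) \<in> {..<symbols M} \<times> {-1, 0, 1}" if "k \<le> i" "i < k + tapes M"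
      using d(2,3) that nth_mem[of "i - k" "snd ?d"] by auto
    then have "fst (snd ?d ! (i - k)) < S \<and> snd (snd ?d ! (i - k)) \<in> {-1, 0, 1}"
      if "k \<le> i" "i < k + tapes M"
      using that S by (auto simp: mem_Times_iff)
    then show ?thesis using True d(1) S v by (auto simp: Let_def)
  next
    case False
    then show ?thesis using v by (auto simp: Let_def)
  qed
  ultimately show ?thesis unfolding call_def wf_prog.simps using T by blast
qed

text \<open>Each machine step costs a loop test and an action, and one last test ends the loop,
  hence \<open>2 * n + 1\<close>. If \<open>M\<close> halts early, its remaining steps are idle and
  the loop has already ended.\<close>

lemma runs_call:
  assumes M: "turing_machine M"
    and "bounded_config M N (q, map g [k..<k + tapes M])" "N \<ge> 1"
    and "g (k + tapes M) = cell q"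
    and "(step M ^^ n) (q, map g [k..<k + tapes M]) = (1, ts)"
  shows "\<exists>g'. runs (call M k) g (2 * n + 1) g' \<and> map g' [k..<k + tapes M] = ts \<and>
     (\<forall>i. i < k \<or> i > k + tapes M \<longrightarrow> g' i = g i)"
  using assms(2-)
proof (induction n arbitrary: q g N)
  case 0
  then have "runs (call M k) g 1 g"
    unfolding call_def by (intro runs_While_stop) (auto simp: cell_def)
  then show ?case using 0 by auto
next
  case (Suc n)
  show ?case
  proof (cases "q = 1")
    case True
    then have "runs (call M k) g 1 g"
      unfolding call_def using Suc.prems(3) by (intro runs_While_stop) (auto simp: cell_def)
    then have "runs (call M k) g (2 * Suc n + 1) g" by (rule runs_mono) simp
    moreover have "map g [k..<k + tapes M] = ts"
      using Suc.prems(4) True step_halted[of "(q, map g [k..<k + tapes M])" "Suc n" M] by simp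
    ultimately show ?thesis by blast
  next
    case False
    let ?ts = "map g [k..<k + tapes M]"
    let ?ss = "map (\<lambda>j. g j 0) [k..<k + tapes M]"
    let ?d = "delta M q ?ss"
    let ?g = "\<lambda>i. if i = k + tapes M then cell (fst ?d)
      else if k \<le> i \<and> i < k + tapes M then act (snd ?d ! (i - k)) (g i) else g i"
    have ss: "map (\<lambda>t. t 0) ?ts = ?ss" by simp
    have ok: "q < states M" "set ?ss \<subseteq> {..<symbols M}"
      using Suc.prems(1) by (auto simp: bounded_config_def)
    have d: "length (snd ?d) = tapes M"
      using ok by (intro delta_range[OF M]) simp_all
    have g': "map ?g [k..<k + tapes M] = map2 act (snd ?d) ?ts"
      using d by (intro nth_equalityI) auto
    have step: "step M (q, ?ts) = (fst ?d, map ?g [k..<k + tapes M])"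
      unfolding g' using False by (simp add: step_def Let_def comp_def)
    have "cell q 0 = q" by (simp add: cell_def)
    have cell: "act (q', 0) (cell q) = cell q'" for q' by (auto simp: act_def cell_def)
    let ?f = "\<lambda>v i.
     let q = v (k + tapes M); ss = map v [k..<k + tapes M] in
     if q < states M \<and> set ss \<subseteq> {..<symbols M} then
       if i = k + tapes M then (fst (delta M q ss), 0)
       else if k \<le> i \<and> i < k + tapes M then snd (delta M q ss) ! (i - k)
       else (v i, 0)
     else (v i, 0 :: int)"
    have "(\<lambda>i. act (?f (\<lambda>j. g j 0) i) (g i)) = ?g"
      using ok Suc.prems(3) by (auto simp: Let_def act_stay cell \<open>cell q 0 = q\<close>)
    then have act: "runs (Act ?f) g 1 ?g"
      using runs_Act[of ?f g] by simp
    have "\<exists>g'. runs (call M k) ?g (2 * n + 1) g' \<and> map g' [k..<k + tapes M] = ts \<and>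
        (\<forall>i. i < k \<or> i > k + tapes M \<longrightarrow> g' i = ?g i)"
    proof (rule Suc.IH)
      show "bounded_config M (Suc N) (fst ?d, map ?g [k..<k + tapes M])"
        using bounded_step[OF M Suc.prems(1,2)] step by simp
      show "(step M ^^ n) (fst ?d, map ?g [k..<k + tapes M]) = (1, ts)"
        using Suc.prems(4) by (simp add: funpow_Suc_right step del: funpow.simps)
    qed auto
    then obtain g' where g': "runs (call M k) ?g (2 * n + 1) g'"
      "map g' [k..<k + tapes M] = ts" "\<forall>i. i < k \<or> i > k + tapes M \<longrightarrow> g' i = ?g i"
      by blast
    have "runs (call M k) g (Suc (1 + (2 * n + 1))) g'"
      using g'(1) act False Suc.prems(3) unfolding call_def
      by (intro runs_While_loop[OF _ act]) (auto simp: cell_def)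
    then show ?thesis using g'(2,3) by (intro exI[of _ g']) auto
  qed
qed

lemma runs_computation:
  assumes M: "turing_machine M" and out: "computes_within M x y n"
    and g: "g k = input_tape x" "\<And>i. k < i \<Longrightarrow> i \<le> k + tapes M \<Longrightarrow> g i = input_tape []"
  shows "\<exists>g'. runs (call M k) g (2 * n + 1) g' \<and> carries (g' k) y \<and>
     (\<forall>i. i < k \<or> i > k + tapes M \<longrightarrow> g' i = g i)"
proof -
  have T: "tapes M \<ge> 1" using M by (simp add: turing_machine_def)
  have init: "initial M x = (0, map g [k..<k + tapes M])"
    using T g by (auto simp: initial_def input_tape_def nth_Cons' intro!: nth_equalityI)
  obtain ts where ts: "(step M ^^ n) (initial M x) = (1, ts)" "carries (hd ts) y"
    using out unfolding computes_within_def output_is_def carries_def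
    by (metis prod.collapse)
  have "\<exists>g'. runs (call M k) g (2 * n + 1) g' \<and> map g' [k..<k + tapes M] = ts \<and>
      (\<forall>i. i < k \<or> i > k + tapes M \<longrightarrow> g' i = g i)"
  proof (rule runs_call[OF M])
    show "bounded_config M (Suc (length x)) (0, map g [k..<k + tapes M])"
      using bounded_initial[OF M, of x] init by simp
    show "g (k + tapes M) = cell 0"
      using g(2)[of "k + tapes M"] T by (auto simp: cell_def input_tape_def)
  qed (use ts init in simp_all)
  then obtain g' where g': "runs (call M k) g (2 * n + 1) g'" "map g' [k..<k + tapes M] = ts"
    "\<forall>i. i < k \<or> i > k + tapes M \<longrightarrow> g' i = g i" by blast
  moreover have "hd ts = g' k" using g'(2) T by (auto simp: upt_rec[of k])
  ultimately show ?thesis using ts(2) by auto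
qed

text \<open>Both machines are called from one program. The condition \<open>link\<close> says that
  every acceptable first answer codes an instance of the second problem, and that solving this
  instance answers the original one.\<close>

theorem polytime_compose:
  assumes "polytime_solvable c I Q" "polytime_solvable e J R"
    and link: "\<And>i y. i \<in> I \<Longrightarrow> Q i y \<Longrightarrow> \<exists>j\<in>J. e j = y \<and> (\<forall>z. R j z \<longrightarrow> P i z)"
  shows "polytime_solvable c I P"
proof -
  obtain M1 a1 k1 where M1: "turing_machine M1" and run1:
    "\<And>i. i \<in> I \<Longrightarrow> \<exists>y. Q i y \<and> computes_within M1 (c i) y (a1 * length (c i) ^ k1 + a1)"
    using assms(1) unfolding polytime_solvable_def by blast
  obtain M2 a2 k2 where M2: "turing_machine M2" and run2:
    "\<And>j. j \<in> J \<Longrightarrow> \<exists>y. R j y \<and> computes_within M2 (e j) y (a2 * length (e j) ^ k2 + a2)"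
    using assms(2) unfolding polytime_solvable_def by blast
  \<comment> \<open>\<open>M2\<close> will occupy tapes 0 to \<open>tapes M2\<close> and
    \<open>M1\<close> the tapes \<open>k\<close> to \<open>k + tapes M1\<close>, so the garbage of
    \<open>M1\<close> cannot disturb \<open>M2\<close>. Tape \<open>x\<close> is for transfer: a
    move reverses a stack, and two moves restore it.\<close>
  define k where "k = tapes M2 + 1"
  define x where "x = k + tapes M1 + 1"
  define p where "p = Seq (move 0 x) (Seq (move x k) (Seq (call M1 k)
    (Seq (move k x) (Seq (move x 0) (call M2 0)))))"
  define S where "S = 3 + states M1 + symbols M1 + states M2 + symbols M2"
  have wf: "wf_prog (x + 1) S p"
    unfolding p_def using wf_call[OF M1, of k "x + 1" S] wf_call[OF M2, of 0 "x + 1" S]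
    by (simp add: S_def x_def k_def)
  define t1 where "t1 n = a1 * n ^ k1 + a1" for n
  define l where "l n = n + t1 n + 1" for n
  define t where "t n = 14 * n + 2 * t1 n + 14 * l n + 2 * (a2 * l n ^ k2 + a2) + 50" for n
  have t: "poly_bounded t"
    unfolding t_def l_def t1_def by (intro poly_bounded_intros)
  show ?thesis
  proof (rule polytime_solvable_store[OF wf _ _ t])
    fix i assume "i \<in> I"
    then obtain y where y: "Q i y" "computes_within M1 (c i) y (t1 (length (c i)))"
      using run1 t1_def by metis
    obtain j where j: "j \<in> J" "e j = y" "\<And>z. R j z \<Longrightarrow> P i z"
      using link[OF \<open>i \<in> I\<close> y(1)] by blast
    then obtain z where z: "R j z" "computes_within M2 y z (a2 * length y ^ k2 + a2)"
      using run2 by metis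
    let ?n = "length (c i)"
    have ly: "length y \<le> l ?n" using output_length[OF M1 y(2)] by (simp add: l_def)
    have kx: "0 < k" "k < x" "0 \<noteq> x" "x \<noteq> k" by (auto simp: k_def x_def)
    have r1: "srun (move 0 x) (start (c i)) (7 * ?n + 1) ((\<lambda>_. [])(x := rev (c i)))"
      by (rule srun_weaken[OF srun_move]) (use kx in \<open>auto simp: start_def\<close>)
    have r2: "srun (move x k) ((\<lambda>_. [])(x := rev (c i))) (7 * ?n + 1) ((\<lambda>_. [])(k := c i))"
      by (rule srun_weaken[OF srun_move]) (use kx in auto)
    obtain g3 where g3: "runs (call M1 k) (bank ((\<lambda>_. [])(k := c i))) (2 * t1 ?n + 1) g3"
      "carries (g3 k) y"
      "\<forall>i'. i' < k \<or> i' > k + tapes M1 \<longrightarrow> g3 i' = input_tape []"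
      using runs_computation[OF M1 y(2), of "bank ((\<lambda>_. [])(k := c i))" k] by (auto simp: bank_def)
    have "g3 x = input_tape []" using g3(3) by (simp add: x_def)
    from runs_move[OF kx(4)[symmetric] g3(2) this] obtain s where
      r4: "runs (move k x) g3 (7 * length y + 1) (g3(k := s, x := input_tape (rev y)))" by auto
    let ?g4 = "g3(k := s, x := input_tape (rev y))"
    have "carries (?g4 x) (rev y)" "?g4 0 = input_tape []"
      using g3(3) kx by (auto simp: carries_input_tape)
    from runs_move[OF kx(3)[symmetric] this, unfolded length_rev rev_rev_ident append_Nil2]
    obtain s' where
      r5: "runs (move x 0) ?g4 (7 * length y + 1) (?g4(x := s', 0 := input_tape y))" by blast
    let ?g5 = "?g4(x := s', 0 := input_tape y)"
    \<comment> \<open>The tapes of \<open>M2\<close> other than tape 0 lie below \<open>k\<close>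
      and were not touched by the first call.\<close>
    have "?g5 i' = input_tape []" if "0 < i'" "i' \<le> 0 + tapes M2" for i'
      using that g3(3) kx by (auto simp: k_def x_def)
    then obtain g6 where g6: "runs (call M2 0) ?g5 (2 * (a2 * length y ^ k2 + a2) + 1) g6"
      "carries (g6 0) z"
      using runs_computation[OF M2 z(2), of ?g5 0] by auto
    have "runs p (bank (start (c i))) (Suc (7 * ?n + 1 + Suc (7 * ?n + 1 + Suc (2 * t1 ?n + 1 +
        Suc (7 * length y + 1 + Suc (7 * length y + 1 + (2 * (a2 * length y ^ k2 + a2) + 1))))))) g6"
      unfolding p_def
      by (rule runs_Seq[OF r1 runs_Seq[OF r2 runs_Seq[OF g3(1) runs_Seq[OF r4 runs_Seq[OF r5 g6(1)]]]]])
    moreover have "a2 * length y ^ k2 \<le> a2 * l ?n ^ k2"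
      using ly by (simp add: power_mono)
    \<comment> \<open>With the powers abstracted to variables the comparison of running times is
      linear.\<close>
    moreover have "Suc (7 * n + 1 + Suc (7 * n + 1 + Suc (2 * t1 + 1 + Suc (7 * m + 1 +
        Suc (7 * m + 1 + (2 * (u + a2) + 1)))))) \<le> 14 * n + 2 * t1 + 14 * m' + 2 * (u' + a2) + 50"
      if "u \<le> u'" "m \<le> m'" for n m m' t1 u u' :: nat using that by simp
    ultimately have "runs p (bank (start (c i))) (t ?n) g6"
      using ly unfolding t_def by (meson runs_mono)
    then show "\<exists>g y. runs p (bank (start (c i))) (t ?n) g \<and> carries (g 0) y \<and> P i y"
      using g6(2) j(3)[OF z(1)] by blast
  qed (auto simp: S_def)
qed

lemma polytime_solvable_stacks:
  assumes "wf_prog T 3 p" "T \<ge> 1" "poly_bounded t"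
    and "\<And>i. i \<in> I \<Longrightarrow> \<exists>r. srun p (start (enc i)) (t (length (enc i))) r \<and> R i (r 0)"
  shows "polytime_solvable enc I R"
proof (rule polytime_solvable_store[OF assms(1,2) _ assms(3)])
  fix i assume "i \<in> I"
  then obtain r where "srun p (start (enc i)) (t (length (enc i))) r" "R i (r 0)"
    using assms(4) by blast
  then show "\<exists>g y. runs p (bank (start (enc i))) (t (length (enc i))) g \<and> carries (g 0) y \<and> R i y"
    by (intro exI[of _ "bank r"] exI[of _ "r 0"]) (simp add: bank_def carries_input_tape)
qed simp

section \<open>Elementary polynomial-time functions\<close>

definition skip :: prog where
  "skip = Act (\<lambda>v i. (v i, 0))"

abbreviation erase :: "nat \<Rightarrow> prog" where
  "erase j \<equiv> each j (\<lambda>_. skip)"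

primrec push_word :: "nat \<Rightarrow> bool list \<Rightarrow> prog" where
  "push_word j [] = skip"
| "push_word j (b # w) = Seq (push_word j w) (push j b)"

text \<open>Pushing \<open>b\<close> and then \<open>True\<close> builds the first part of a
  \<open>pair_code\<close> from its end, so tape \<open>i\<close> must hold the word in
  reverse.\<close>

definition push_pairs :: "nat \<Rightarrow> nat \<Rightarrow> prog" where
  "push_pairs i j = each i (\<lambda>b. Seq (push j b) (push j True))"

lemma srun_change:
  "srun p r n r' \<Longrightarrow> r = q \<Longrightarrow> r' = q' \<Longrightarrow> n \<le> n' \<Longrightarrow> srun p q n' q'"
  using runs_mono by blast

lemma wf_skip [simp]: "wf_prog T S skip"
  by (simp add: skip_def)

lemma wf_push_word [simp]: "3 \<le> S \<Longrightarrow> wf_prog T S (push_word j w)"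
  by (induction w) auto

lemma wf_push_pairs [simp]: "3 \<le> S \<Longrightarrow> i < T \<Longrightarrow> wf_prog T S (push_pairs i j)"
  by (simp add: push_pairs_def)

lemma srun_skip: "srun skip r 1 r"
  using runs_Act[of "\<lambda>v i. (v i, 0)" "bank r"] by (simp add: skip_def act_stay)

lemma srun_erase: "srun (erase j) r (5 * length (r j) + 1) (r(j := []))"
  using srun_each[of "\<lambda>_ xs. r(j := xs)" j "\<lambda>_. skip" 1 "[]" "r j"] srun_skip by simp

lemma srun_push_word: "srun (push_word j w) r (4 * length w + 1) (r(j := w @ r j))"
proof (induction w)
  case Nil
  then show ?case using srun_skip by simp
next
  case (Cons b w)
  show ?case by (simp, rule srun_weaken, rule runs_Seq, rule Cons, rule srun_push) auto
qed

lemma srun_push_pairs: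
  assumes "i \<noteq> j"
  shows "srun (push_pairs i j) r (11 * length (r i) + 1)
    (r(i := [], j := concat (map (\<lambda>b. [True, b]) (rev (r i))) @ r j))"
proof -
  define R where "R ys xs = r(i := xs, j := concat (map (\<lambda>b. [True, b]) ys) @ r j)" for ys xs
  have body: "srun (Seq (push j b) (push j True)) ((R ys (b # xs))(i := xs)) 7 (R (b # ys) xs)" for ys b xs
    by (rule srun_weaken, rule runs_Seq, rule srun_push, rule srun_push)
       (use assms in \<open>auto simp: R_def fun_eq_iff\<close>)
  have "srun (push_pairs i j) (R [] (r i)) ((7 + 4) * length (r i) + 1) (R (rev (r i) @ []) [])"
    unfolding push_pairs_def by (rule srun_each[where R = R, OF _ body]) (use assms in \<open>simp add: R_def\<close>)
  moreover have "R [] (r i) = r" by (auto simp: R_def)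
  ultimately show ?thesis by (simp add: R_def)
qed

lemma srun_while_true_unary:
  assumes "r i = replicate m True @ zs" "\<not> (\<exists>xs. zs = True # xs)" "i \<noteq> j"
  shows "srun (while_true i (push j b)) r (6 * m + 1) (r(i := zs, j := replicate m b @ r j))"
proof -
  define R where "R k m = r(i := replicate m True @ zs, j := replicate k b @ r j)" for k m
  have body: "srun (push j b) ((R k (Suc m))(i := replicate m True @ zs)) 3 (R (Suc k) m)" for k m
    by (rule srun_weaken, rule srun_push) (use assms in \<open>auto simp: R_def fun_eq_iff\<close>)
  have "srun (while_true i (push j b)) (R 0 m) ((3 + 3) * m + 1) (R (0 + m) 0)"
    by (rule srun_while_true[where R = R, OF _ assms(2) body]) (use assms in \<open>simp add: R_def\<close>)
  moreover have "R 0 m = r" using assms by (auto simp: R_def)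
  ultimately show ?thesis by (simp add: R_def)
qed

lemma dropWhile_id_neq: "dropWhile id x \<noteq> True # xs"
  by (induction x) auto

section \<open>Constants, prefixes and prefix tests\<close>

lemma polytime_const: "polytime_solvable (\<lambda>x. x) UNIV (\<lambda>_ y. y = w)"
proof (rule polytime_solvable_stacks[where T = 1 and t = "\<lambda>n. 5 * n + 4 * length w + 3"])
  fix x :: "bool list"
  have "srun (Seq (erase 0) (push_word 0 w)) (start x) (5 * length x + 4 * length w + 3) (start w)"
    by (rule srun_weaken, rule runs_Seq, rule srun_erase, rule srun_push_word)
       (auto simp: start_def)
  then show "\<exists>r. srun (Seq (erase 0) (push_word 0 w)) (start x)
      (5 * length x + 4 * length w + 3) r \<and> r 0 = w"
    by (auto simp: start_def)
qed (auto intro!: poly_bounded_intros)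

lemma polytime_append: "polytime_solvable (\<lambda>x. x) UNIV (\<lambda>x y. y = w @ x)"
proof (rule polytime_solvable_stacks[where T = 1 and t = "\<lambda>n. 4 * length w + 1"])
  fix x :: "bool list"
  show "\<exists>r. srun (push_word 0 w) (start x) (4 * length w + 1) r \<and> r 0 = w @ x"
    using srun_push_word[of 0 w "start x"] by (intro exI conjI, assumption) (simp add: start_def)
qed (auto intro!: poly_bounded_intros)

text \<open>The last stage of the reduction: these two bits of an approximate solution reveal
  whether a witness exists.\<close>

lemma polytime_starts_True_True:
  "polytime_solvable (\<lambda>x. x) UNIV (\<lambda>x y. y = [take 2 x = [True, True]])"
proof -
  let ?out = "\<lambda>b. Seq (erase 0) (push 0 b)"
  let ?q = "branch 0 (?out False) (?out False) (?out True)"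
  let ?p = "branch 0 (?out False) (?out False) (Seq (pop 0) ?q)"
  have out: "srun (?out b) r n r'" if "r' = r(0 := [b])" "5 * length (r 0) + 5 \<le> n" for b r n r'
    by (rule srun_weaken, rule runs_Seq, rule srun_erase, rule srun_push) (use that in auto)
  show ?thesis
  proof (rule polytime_solvable_stacks[where T = 1 and p = ?p and t = "\<lambda>n. Suc (5 * n + 10)"])
    fix x :: "bool list"
    have q: "srun ?q (start x') (Suc (5 * length x' + 5)) (start [take 1 x' = [True]])" for x'
      by (rule srun_branch) (auto simp: start_def split: list.split intro!: out)
    have pop: "srun (pop 0) (start x) 1 (start (tl x))"
      using srun_pop[of 0 "start x"] by (simp add: start_def)
    have "srun (Seq (pop 0) ?q) (start x) (5 * length x + 10) (start [take 1 (tl x) = [True]])"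
      by (rule srun_weaken, rule runs_Seq, rule pop, rule q) auto
    then have "srun ?p (start x) (Suc (5 * length x + 10)) (start [take 2 x = [True, True]])"
      by (intro srun_branch) (cases x; auto simp: start_def intro!: out)
    then show "\<exists>r. srun ?p (start x) (Suc (5 * length x + 10)) r \<and> r 0 = [take 2 x = [True, True]]"
      by (auto simp: start_def)
  qed (auto intro!: poly_bounded_intros simp del: One_nat_def simp flip: Suc_eq_plus1)
qed

section \<open>Polynomials computed in unary\<close>

lemma desc_code_pair: "desc_code (n, s) = replicate n True @ False # s"
  by (simp add: desc_code_def)

text \<open>Multiplies a unary number by the length of the word behind it. Iterating this
  \<open>k\<close> times produces the power in the witness bound.\<close>

lemma polytime_scale:
  "polytime_solvable desc_code UNIV (\<lambda>(m, s) y. y = desc_code (m * length s, s))"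
proof -
  let ?inner = "each 0 (\<lambda>b. Seq (push 2 b) (push 3 True))"
  let ?body = "Seq ?inner (move 2 0)"
  let ?p = "Seq (while_true 0 (push 1 True)) (Seq (pop 0) (Seq (each 1 (\<lambda>_. ?body))
    (Seq (push 0 False) (move 3 0))))"
  let ?t = "\<lambda>n. 6 * n + 1 + ((18 * n + 7) * n + 1) + (7 * (n * n) + 1) + 10"
  have "\<exists>r. srun ?p (start (desc_code (m, s))) (?t (length (desc_code (m, s)))) r \<and>
      r 0 = desc_code (m * length s, s)" for m s
  proof -
    let ?n = "length (desc_code (m, s))"
    have n: "m \<le> ?n" "length s \<le> ?n" by (auto simp: desc_code_pair)
    \<comment> \<open>\<open>a\<close> is the unary counter still to be consumed and
      \<open>k\<close> the product accumulated so far. A round of the outer loop empties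
      \<open>s\<close> onto tape 2, adds its length on tape 3, and moves \<open>s\<close>
      back.\<close>
    define Q where "Q a k = (\<lambda>_::nat. [])(0 := s, 1 := a, 3 := replicate k True)"
      for a :: "bool list" and k
    have inner: "srun ?inner (Q a k) (11 * length s + 1)
        ((\<lambda>_. [])(1 := a, 2 := rev s, 3 := replicate (length s + k) True))" for a k
    proof -
      define R where "R ys xs = (\<lambda>_::nat. [])(0 := xs, 1 := a, 2 := ys,
        3 := replicate (length ys + k) True)" for ys xs :: "bool list"
      have body: "srun (Seq (push 2 b) (push 3 True)) ((R ys (b # xs))(0 := xs)) 7 (R (b # ys) xs)"
        for ys b xs
        by (rule srun_weaken, rule runs_Seq, rule srun_push, rule srun_push)
           (auto simp: R_def fun_eq_iff)
      have "srun ?inner (R [] s) ((7 + 4) * length s + 1) (R (rev s @ []) [])"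
        by (rule srun_each[where R = R, OF _ body]) (simp add: R_def)
      then show ?thesis
        by (rule srun_change) (auto simp: R_def Q_def fun_eq_iff)
    qed
    have body: "srun ?body (Q a k) (18 * length s + 3) (Q a (length s + k))" for a k
      by (rule srun_weaken, rule runs_Seq, rule inner, rule srun_move) (auto simp: Q_def fun_eq_iff)
    have "srun (each 1 (\<lambda>_. ?body)) (Q (replicate m True) (length ([] :: bool list) * length s))
        ((18 * length s + 3 + 4) * length (replicate m True) + 1)
        (Q [] (length (rev (replicate m True) @ []) * length s))"
    proof (rule srun_each)
      fix ys xs :: "bool list" and b
      show "Q xs (length ys * length s) 1 = xs" by (simp add: Q_def)
      show "srun ?body ((Q (b # xs) (length ys * length s))(1 := xs)) (18 * length s + 3)
          (Q xs (length (b # ys) * length s))"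
        by (rule srun_change, rule body[of xs "length ys * length s"]) (auto simp: Q_def fun_eq_iff)
    qed
    then have loop: "srun (each 1 (\<lambda>_. ?body)) (Q (replicate m True) 0)
        ((18 * length s + 7) * m + 1) (Q [] (m * length s))"
      by (rule srun_change) simp_all
    have 1: "srun (while_true 0 (push 1 True)) (start (desc_code (m, s))) (6 * m + 1)
        ((\<lambda>_. [])(0 := False # s, 1 := replicate m True))"
      by (rule srun_weaken, rule srun_while_true_unary[where zs = "False # s" and m = m])
         (auto simp: start_def desc_code_pair)
    have 2: "srun (pop 0) ((\<lambda>_. [])(0 := False # s, 1 := replicate m True)) 1 (Q (replicate m True) 0)"
      by (rule srun_weaken, rule srun_pop) (auto simp: Q_def fun_eq_iff)
    have 3: "srun (Seq (push 0 False) (move 3 0)) (Q [] (m * length s)) (7 * (m * length s) + 5)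
        (start (desc_code (m * length s, s)))"
      by (rule srun_weaken, rule runs_Seq, rule srun_push, rule srun_move)
         (auto simp: Q_def start_def desc_code_pair fun_eq_iff)
    have "srun ?p (start (desc_code (m, s))) (?t ?n) (start (desc_code (m * length s, s)))"
    proof (rule srun_weaken, rule runs_Seq[OF 1 runs_Seq[OF 2 runs_Seq[OF loop 3]]])
      have "m * length s \<le> ?n * ?n" "(18 * length s + 7) * m \<le> (18 * ?n + 7) * ?n"
        using n by (intro mult_mono; simp)+
      then show "Suc (6 * m + 1 + Suc (1 + Suc ((18 * length s + 7) * m + 1 +
          (7 * (m * length s) + 5)))) \<le> ?t ?n"
        using n by linarith
    qed simp
    then show ?thesis by (intro exI conjI, assumption) (simp add: start_def)
  qed
  then show ?thesis
    by (intro polytime_solvable_stacks[where T = 4 and p = ?p and t = ?t])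
       (auto intro!: poly_bounded_intros)
qed

lemma polytime_power:
  "polytime_solvable (\<lambda>s. s) UNIV (\<lambda>s y. y = desc_code (a * length s ^ k + b, s))"
proof -
  have prepend: "polytime_solvable c I (\<lambda>i y. y = w @ h i)"
    if "polytime_solvable c I (\<lambda>i y. y = h i)" for c :: "bool list \<Rightarrow> bool list" and I w h
    by (rule polytime_compose[OF that polytime_append[of w]]) simp
  have "polytime_solvable (\<lambda>s. s) UNIV (\<lambda>s y. y = desc_code (a * length s ^ k, s))"
  proof (induction k)
    case 0
    then show ?case
      using polytime_append[of "replicate a True @ [False]"] by (simp add: desc_code_pair)
  next
    case (Suc k)
    show ?case
      by (rule polytime_compose[OF Suc polytime_scale]) (auto simp: desc_code_inject ac_simps)
  qed
  \<comment> \<open>Putting \<open>b\<close> further copies of \<open>True\<close> in front of a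
    description code adds \<open>b\<close> to its unary number.\<close>
  from prepend[OF this, of "replicate b True"] show ?thesis
    by (simp add: desc_code_pair replicate_add[symmetric] add.commute flip: append_assoc)
qed

section \<open>Encoding of the max-min instance\<close>

definition weights :: "nat \<Rightarrow> nat list" where
  "weights n = [1, 1] @ replicate (n - 2) 0"

lemma binary_0: "binary 0 = []" and binary_1: "binary 1 = [True]"
  by (simp_all add: binary.simps)

text \<open>\<open>B\<close> and the two unit weights each contribute
  \<open>True, True, False\<close>, and a zero weight only \<open>False\<close>, so the instance can
  be written without arithmetic on binary numbers.\<close>

lemma instance_code_weights:
  "instance_code ((n, s), weights n, 1) = pair_code (desc_code (n, s))
     ([True, True, False, True, True, False, True, True, False] @ replicate (n - 2) False)"
proof -
  have "concat (replicate k [False]) = replicate k False" for k by (induction k) auto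
  then show ?thesis
    by (simp add: instance_code_def weights_def binary_0 binary_1[unfolded One_nat_def] pair_code_def)
qed

lemma polytime_encode:
  "polytime_solvable desc_code UNIV (\<lambda>(n, s) y. y = instance_code ((n, s), weights n, 1))"
proof -
  \<comment> \<open>The loop restores the unary number on tape 0 and puts \<open>n\<close> copies of
    \<open>False\<close> on tape 3. Two pops reduce them to \<open>n - 2\<close> zero weights; the
    first bit of \<open>?w\<close> is the separator of the outer pair.\<close>
  let ?loop = "each 1 (\<lambda>_. Seq (push 0 True) (push 3 False))"
  let ?w = "[False, True, True, False, True, True, False, True, True, False]"
  let ?p = "Seq (while_true 0 (push 1 True)) (Seq ?loop (Seq (move 0 2) (Seq (move 3 0)
    (Seq (pop 0) (Seq (pop 0) (Seq (push_word 0 ?w) (push_pairs 2 0)))))))"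
  have "\<exists>r. srun ?p (start (desc_code (n, s))) (100 * length (desc_code (n, s)) + 100) r \<and>
      r 0 = instance_code ((n, s), weights n, 1)" for n s
  proof -
    define R where "R ys xs = (\<lambda>_::nat. [])(0 := replicate (length ys) True @ False # s, 1 := xs,
      3 := replicate (length ys) False)" for ys xs :: "bool list"
    have 1: "srun (while_true 0 (push 1 True)) (start (desc_code (n, s))) (6 * n + 1)
        (R [] (replicate n True))"
      by (rule srun_weaken, rule srun_while_true_unary[where zs = "False # s" and m = n])
         (auto simp: R_def start_def desc_code_pair fun_eq_iff)
    have body: "srun (Seq (push 0 True) (push 3 False)) ((R ys (b # xs))(1 := xs)) 7 (R (b # ys) xs)"
      for ys b xs
      by (rule srun_weaken, rule runs_Seq, rule srun_push, rule srun_push)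
         (auto simp: R_def fun_eq_iff)
    have 2: "srun ?loop (R [] (replicate n True)) ((7 + 4) * length (replicate n True) + 1)
        (R (rev (replicate n True) @ []) [])"
      by (rule srun_each[where R = R, OF _ body]) (simp add: R_def)
    have tl: "tl (tl (replicate n False)) = replicate (n - 2) False"
      by (cases n; cases "n - 1") auto
    have 3: "srun (Seq (move 0 2) (Seq (move 3 0) (Seq (pop 0) (Seq (pop 0)
          (Seq (push_word 0 ?w) (push_pairs 2 0)))))) (R (rev (replicate n True) @ []) [])
        (80 * length (desc_code (n, s)) + 80) (start (instance_code ((n, s), weights n, 1)))"
      by (rule srun_weaken, rule runs_Seq, rule srun_move, simp, rule runs_Seq, rule srun_move, simp,
          rule runs_Seq, rule srun_pop, rule runs_Seq, rule srun_pop, rule runs_Seq,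
          rule srun_push_word, rule srun_push_pairs, simp)
         (auto simp: R_def start_def instance_code_weights[unfolded One_nat_def] desc_code_pair pair_code_def tl fun_eq_iff)
    have "srun ?p (start (desc_code (n, s))) (100 * length (desc_code (n, s)) + 100)
        (start (instance_code ((n, s), weights n, 1)))"
      by (rule srun_weaken, rule runs_Seq[OF 1 runs_Seq[OF 2 3]]) (auto simp: desc_code_pair)
    then show ?thesis by (intro exI conjI, assumption) (simp add: start_def)
  qed
  then show ?thesis
    by (intro polytime_solvable_stacks[where T = 4 and p = ?p and t = "\<lambda>n. 100 * n + 100"])
       (auto intro!: poly_bounded_intros)
qed

lemma polytime_trivial_solution:
  "polytime_solvable desc_code {(n, s). n \<ge> 1} (\<lambda>(n, s) y. y = False # replicate (n - 1) True)"
proof -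
  let ?p = "Seq (while_true 0 (push 1 True)) (Seq (erase 0) (Seq (pop 1)
    (Seq (move 1 0) (push 0 False))))"
  have "\<exists>r. srun ?p (start (desc_code (n, s))) (20 * length (desc_code (n, s)) + 20) r \<and>
      r 0 = False # replicate (n - 1) True" if "n \<ge> 1" for n s
  proof -
    have tl: "tl (replicate n True) = replicate (n - 1) True" by (cases n) auto
    have 1: "srun (while_true 0 (push 1 True)) (start (desc_code (n, s))) (6 * n + 1)
        ((\<lambda>_. [])(0 := False # s, 1 := replicate n True))"
      by (rule srun_weaken, rule srun_while_true_unary[where zs = "False # s" and m = n])
         (auto simp: start_def desc_code_pair fun_eq_iff)
    have "srun ?p (start (desc_code (n, s))) (20 * length (desc_code (n, s)) + 20)
        (start (False # replicate (n - 1) True))"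
      by (rule srun_weaken, rule runs_Seq, rule 1, rule runs_Seq, rule srun_erase, rule runs_Seq,
          rule srun_pop, rule runs_Seq, rule srun_move, simp, rule srun_push)
         (auto simp: start_def desc_code_pair fun_eq_iff tl)
    then show ?thesis by (intro exI conjI, assumption) (simp add: start_def)
  qed
  then show ?thesis
    by (intro polytime_solvable_stacks[where T = 2 and p = ?p and t = "\<lambda>n. 20 * n + 20"])
       (auto intro!: poly_bounded_intros)
qed

section \<open>Decoding of pairs\<close>

fun code_fst :: "bool list \<Rightarrow> bool list" where
  "code_fst (True # b # z) = b # code_fst z"
| "code_fst [True] = []"
| "code_fst (False # z) = []"
| "code_fst [] = []"

text \<open>Like \<open>code_fst\<close> it is total, as languages in P are decided on malformed
  strings too. It keeps the separating \<open>False\<close>, because the loop in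
  \<open>unpair\<close> stops there without popping.\<close>

fun code_tail :: "bool list \<Rightarrow> bool list" where
  "code_tail (True # b # z) = code_tail z"
| "code_tail [True] = []"
| "code_tail (False # z) = False # z"
| "code_tail [] = []"

definition unpair :: "nat \<Rightarrow> nat \<Rightarrow> prog" where
  "unpair i j = while_true i
     (branch i skip (Seq (pop i) (push j False)) (Seq (pop i) (push j True)))"

lemma code_pair_code [simp]:
  "code_fst (pair_code u v) = u" "code_tail (pair_code u v) = False # v"
  by (induction u) (auto simp: pair_code_def)

lemma length_pair_code: "length (pair_code u v) = 2 * length u + 1 + length v"
  by (induction u) (auto simp: pair_code_def)

lemma wf_unpair [simp]: "3 \<le> S \<Longrightarrow> i < T \<Longrightarrow> wf_prog T S (unpair i j)"
  by (simp add: unpair_def)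

lemma srun_unpair:
  assumes "i \<noteq> j"
  shows "srun (unpair i j) r (9 * length (r i) + 1)
    (r(i := code_tail (r i), j := rev (code_fst (r i)) @ r j))"
proof (induction "r i" arbitrary: r rule: code_fst.induct)
  case (1 b z)
  let ?r = "r(i := z, j := b # r j)"
  let ?body = "branch i skip (Seq (pop i) (push j False)) (Seq (pop i) (push j True))"
  have "srun (Seq (pop i) (push j b)) (r(i := b # z)) (Suc (1 + 3)) ?r"
    by (rule srun_weaken, rule runs_Seq, rule srun_pop, rule srun_push)
       (use assms in \<open>auto simp: fun_eq_iff\<close>)
  then have body: "srun ?body (r(i := b # z)) (Suc (Suc (1 + 3))) ?r"
    by (intro srun_branch) (cases b; simp)
  have "z = ?r i" using assms by simp
  from srun_while_true_loop[OF 1(2)[symmetric] body 1(1)[of ?r, OF this, unfolded unpair_def]]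
  show ?case
    unfolding unpair_def
    by (rule srun_weaken) (use assms 1(2)[symmetric] in \<open>auto simp: fun_eq_iff\<close>)
next
  case 2
  let ?body = "branch i skip (Seq (pop i) (push j False)) (Seq (pop i) (push j True))"
  have body: "srun ?body (r(i := [])) (Suc 1) (r(i := []))"
    by (intro srun_branch) (simp add: srun_skip[unfolded One_nat_def])
  have stop: "srun (while_true i ?body) (r(i := [])) 1 (r(i := []))"
    by (rule srun_while_true_stop) simp
  show ?case
    unfolding unpair_def
    by (rule srun_weaken, rule srun_while_true_loop[OF 2[symmetric] body stop])
       (use assms 2[symmetric] in \<open>auto simp: fun_eq_iff\<close>)
next
  case (3 z)
  then show ?case
    unfolding unpair_def
    by (intro srun_weaken[OF srun_while_true_stop]) (use 3[symmetric] assms in auto)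
next
  case 4
  then show ?case
    unfolding unpair_def
    by (intro srun_weaken[OF srun_while_true_stop]) (use 4[symmetric] assms in auto)
qed

text \<open>Provides the verifier that ignores its witness, for the inclusion of P in NP.\<close>

lemma polytime_code_fst: "polytime_solvable (\<lambda>x. x) UNIV (\<lambda>z y. y = code_fst z)"
proof -
  let ?p = "Seq (unpair 0 1) (Seq (erase 0) (move 1 0))"
  have le: "length (code_fst z) \<le> length z" "length (code_tail z) \<le> length z" for z
    by (induction z rule: code_fst.induct) auto
  have "srun ?p (start z) (30 * length z + 30) (start (code_fst z))" for z
    by (rule srun_weaken, rule runs_Seq, rule srun_unpair, simp, rule runs_Seq, rule srun_erase,
        rule srun_move, simp) (use le[of z] in \<open>auto simp: start_def fun_eq_iff\<close>)
  then have "\<exists>r. srun ?p (start z) (30 * length z + 30) r \<and> r 0 = code_fst z" for z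
    by (intro exI conjI, assumption) (simp add: start_def)
  then show ?thesis
    by (intro polytime_solvable_stacks[where T = 2 and p = ?p and t = "\<lambda>n. 30 * n + 30"])
       (auto intro!: poly_bounded_intros)
qed

section \<open>The feasibility test as one query to the verifier\<close>

lemma srun_drop_True: "srun (while_true i skip) r (4 * length (r i) + 1) (r(i := dropWhile id (r i)))"
proof (induction "r i" arbitrary: r)
  case Nil
  then show ?case by (intro srun_weaken[OF srun_while_true_stop]) (auto simp: Nil[symmetric])
next
  case (Cons b xs)
  show ?case
  proof (cases b)
    case True
    have "xs = (r(i := xs)) i" by simp
    from srun_while_true_loop[OF _ srun_skip Cons(1)[of "r(i := xs)", OF this]] show ?thesis
      by (rule srun_weaken) (use True Cons(2)[symmetric] in auto)
  next
    case False
    then show ?thesis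
      by (intro srun_weaken[OF srun_while_true_stop]) (auto simp: Cons(2)[symmetric])
  qed
qed

text \<open>Records the output tape only: the branches of the query program leave different contents
  on the other tapes, and this lets them be joined.\<close>

definition yields :: "prog \<Rightarrow> (nat \<Rightarrow> bool list) \<Rightarrow> nat \<Rightarrow> bool list \<Rightarrow> bool" where
  "yields p r n y \<longleftrightarrow> (\<exists>r'. srun p r n r' \<and> r' 0 = y)"

lemma yields_last: "srun p r n r' \<Longrightarrow> r' 0 = y \<Longrightarrow> n \<le> n' \<Longrightarrow> yields p r n' y"
  unfolding yields_def using runs_mono by blast

lemma yields_mono: "yields p r n y \<Longrightarrow> n \<le> n' \<Longrightarrow> yields p r n' y"
  unfolding yields_def using runs_mono by blast

lemma yields_Seq:
  assumes "srun p r n r'" "yields q r' n' y" "n + n' < m"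
  shows "yields (Seq p q) r m y"
proof -
  obtain r'' where "srun q r' n' r''" "r'' 0 = y"
    using assms(2) unfolding yields_def by blast
  then show ?thesis
    using yields_last[OF runs_Seq[OF assms(1)]] assms(3) by simp
qed

lemma yields_branch:
  assumes "r j = [] \<Longrightarrow> yields p0 r n y"
    and "\<And>xs. r j = False # xs \<Longrightarrow> yields pF r n y"
    and "\<And>xs. r j = True # xs \<Longrightarrow> yields pT r n y"
    and "n < n'"
  shows "yields (branch j p0 pF pT) r n' y"
proof -
  have "yields (case r j of [] \<Rightarrow> p0 | b # _ \<Rightarrow> if b then pT else pF) r n y"
  proof (cases "r j")
    case (Cons b xs)
    then show ?thesis using assms(2,3)[of xs] by (cases b) simp_all
  qed (use assms(1) in simp)
  then obtain r' where "srun (case r j of [] \<Rightarrow> p0 | b # _ \<Rightarrow> if b then pT else pF) r n r'" "r' 0 = y"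
    unfolding yields_def by blast
  then show ?thesis
    using yields_last[OF srun_branch] assms(4) by simp
qed

lemma yields_eq: "yields p r n y \<Longrightarrow> y = y' \<Longrightarrow> yields p r n y'"
  by simp

text \<open>A feasible vector is either \<open>False # z\<close> or \<open>True\<^sup>j # False # u\<close> with \<open>j \<ge> 2\<close> and a witness \<open>u\<close>;
  \<open>v0\<close> and \<open>v1\<close> stand for a fixed no-instance and yes-instance of the verifier.\<close>

definition witness_query ::
    "bool list \<Rightarrow> bool list \<Rightarrow> nat \<Rightarrow> bool list \<Rightarrow> bool list \<Rightarrow> bool list" where
  "witness_query v0 v1 n s x = (if length x \<noteq> n then v0 else case x of
     [] \<Rightarrow> v0
   | b # x' \<Rightarrow> if \<not> b then v1 else (case x' of
       [] \<Rightarrow> v0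
     | b' # _ \<Rightarrow> if \<not> b' then v0 else (case dropWhile id x' of
         [] \<Rightarrow> v0
       | _ # u \<Rightarrow> pair_code s u)))"

text \<open>Reduces feasibility to membership in \<open>V\<close>: every case, also one settled by
  the form of \<open>x\<close> alone, becomes a single query.\<close>

lemma polytime_witness_query:
  "polytime_solvable (\<lambda>(d, x). pair_code (desc_code d) x) UNIV
     (\<lambda>((n, s), x) y. y = witness_query v0 v1 n s x)"
proof -
  let ?out = "\<lambda>v. Seq (erase 0) (push_word 0 v)"
  let ?emit = "Seq (pop 0) (Seq (push 0 False) (Seq (move 2 1) (push_pairs 1 0)))"
  let ?TT = "Seq (while_true 0 skip) (branch 0 (?out v0) ?emit ?emit)"
  let ?T = "Seq (pop 0) (branch 0 (?out v0) (?out v0) ?TT)"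
  let ?ok = "branch 0 (?out v0) (?out v1) ?T"
  let ?fin = "branch 3 (branch 4 ?ok (?out v0) (?out v0)) (?out v0) (?out v0)"
  \<comment> \<open>Compares the length of \<open>x\<close> with the unary \<open>n\<close> on tape
    3. Each bit of \<open>x\<close> cancels one unit, and surplus bits are counted on tape 4, so the
    lengths agree iff both tapes end up empty.\<close>
  let ?check = "each 0 (\<lambda>b. Seq (push 1 b) (branch 3 (push 4 True) (pop 3) (pop 3)))"
  let ?decode = "Seq (unpair 0 1) (Seq (pop 0) (Seq (move 1 2) (Seq (while_true 2 (push 3 True)) (pop 2))))"
  let ?p = "Seq ?decode (Seq ?check (Seq (move 1 0) ?fin))"
  let ?N = "\<lambda>r. 20 * (length (r 0) + length (r 2) + length v0 + length v1)"

  have out: "yields (?out v) r n v" if "5 * length (r 0) + 4 * length v + 3 \<le> n" for v n r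
    by (rule yields_last, rule runs_Seq, rule srun_erase, rule srun_push_word)
       (use that in auto)
  have emit: "yields ?emit r n (pair_code (r 2) u)"
    if "r 0 = b # u" "r 1 = []" "18 * length (r 2) + 20 \<le> n" for r b u n
    by (rule yields_last, rule runs_Seq, rule srun_pop, rule runs_Seq, rule srun_push,
        rule runs_Seq, rule srun_move, simp, rule srun_push_pairs, simp)
       (use that in \<open>auto simp: pair_code_def\<close>)
  have TT: "yields ?TT r (?N r + 30) (case dropWhile id (r 0) of [] \<Rightarrow> v0 | _ # u \<Rightarrow> pair_code (r 2) u)"
    if "r 1 = []" for r
  proof (rule yields_Seq[OF srun_drop_True])
    let ?r = "r(0 := dropWhile id (r 0))"
    let ?n = "16 * length (r 0) + 20 * (length (r 2) + length v0) + 20"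
    show "yields (branch 0 (?out v0) ?emit ?emit) ?r (Suc ?n)
        (case dropWhile id (r 0) of [] \<Rightarrow> v0 | _ # u \<Rightarrow> pair_code (r 2) u)"
    proof (rule yields_branch[where n = ?n])
      assume "?r 0 = []"
      then show "yields (?out v0) ?r ?n
          (case dropWhile id (r 0) of [] \<Rightarrow> v0 | _ # u \<Rightarrow> pair_code (r 2) u)"
        by (intro yields_eq[OF out]) (simp_all del: dropWhile_eq_Nil_conv)
    next
      fix u assume u: "?r 0 = False # u"
      have "yields ?emit ?r ?n (pair_code (?r 2) u)"
        by (rule emit[of ?r False u, OF u]) (use that in simp_all)
      then show "yields ?emit ?r ?n
          (case dropWhile id (r 0) of [] \<Rightarrow> v0 | _ # u \<Rightarrow> pair_code (r 2) u)"
        by (rule yields_eq) (use u in simp)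
    next
      fix u assume "?r 0 = True # u"
      then show "yields ?emit ?r ?n
          (case dropWhile id (r 0) of [] \<Rightarrow> v0 | _ # u \<Rightarrow> pair_code (r 2) u)"
        by (simp add: dropWhile_id_neq)
    qed simp
  qed simp
  have T: "yields ?T r (?N r + 40) (case tl (r 0) of [] \<Rightarrow> v0
      | b # _ \<Rightarrow> if \<not> b then v0 else (case dropWhile id (tl (r 0)) of
          [] \<Rightarrow> v0 | _ # u \<Rightarrow> pair_code (r 2) u))" if "r 1 = []" for r
  proof (rule yields_Seq[OF srun_pop])
    let ?r = "r(0 := tl (r 0))"
    have *: "yields ?TT ?r (?N r + 30) (case dropWhile id (tl (r 0)) of
        [] \<Rightarrow> v0 | _ # u \<Rightarrow> pair_code (r 2) u)"
    proof -
      have r: "?r 0 = tl (r 0)" "?r 1 = r 1" "?r 2 = r 2" by simp_all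
      show ?thesis
        by (rule yields_mono[OF TT[of ?r, unfolded r, OF that]]) simp
    qed
    have "5 * length (?r 0) + 4 * length v0 + 3 \<le> ?N r + 30" by simp
    then have v0: "yields (?out v0) ?r (?N r + 30) v0" by (rule out)
    show "yields (branch 0 (?out v0) (?out v0) ?TT) ?r (Suc (?N r + 30))
      (case tl (r 0) of [] \<Rightarrow> v0
      | b # _ \<Rightarrow> if \<not> b then v0 else (case dropWhile id (tl (r 0)) of
          [] \<Rightarrow> v0 | _ # u \<Rightarrow> pair_code (r 2) u))"
      by (rule yields_branch[OF yields_eq[OF v0] yields_eq[OF v0] yields_eq[OF *]]) simp_all
  qed simp
  have fin: "yields ?fin r (?N r + 50) (if r 3 = [] \<and> r 4 = []
      then witness_query v0 v1 (length (r 0)) (r 2) (r 0) else v0)" if "r 1 = []" for r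
  proof -
    have v0: "yields (?out v0) r m v0" if "?N r + 40 \<le> m" for m
      using out[of r v0] that by simp
    have v1: "yields (?out v1) r (?N r + 40) v1"
      using out[of r v1] by simp
    have ok: "yields ?ok r (Suc (?N r + 40)) (witness_query v0 v1 (length (r 0)) (r 2) (r 0))"
      by (rule yields_branch[OF yields_eq[OF v0] yields_eq[OF v1] yields_eq[OF T[of r, OF that]]])
         (simp_all add: witness_query_def split: list.split)
    have 4: "yields (branch 4 ?ok (?out v0) (?out v0)) r (Suc (Suc (?N r + 40)))
        (if r 4 = [] then witness_query v0 v1 (length (r 0)) (r 2) (r 0) else v0)"
      by (rule yields_branch[OF yields_eq[OF ok] yields_eq[OF v0] yields_eq[OF v0]]) simp_all
    have "yields ?fin r (Suc (Suc (Suc (?N r + 40)))) (if r 3 = [] \<and> r 4 = []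
        then witness_query v0 v1 (length (r 0)) (r 2) (r 0) else v0)"
      by (rule yields_branch[OF yields_eq[OF 4] yields_eq[OF v0] yields_eq[OF v0]]) simp_all
    then show ?thesis by (rule yields_mono) simp
  qed

  have main: "yields ?p (start (pair_code (desc_code (n, s)) x))
      (100 * length (pair_code (desc_code (n, s)) x) + 20 * (length v0 + length v1) + 200)
      (witness_query v0 v1 n s x)" for n s x
  proof -
    define Q where "Q = (\<lambda>_::nat. [])(0 := x, 2 := s, 3 := replicate n True)"
    \<comment> \<open>Truncated subtraction expresses both phases at once: units of \<open>n\<close>
      not yet matched on tape 3, and bits in excess of \<open>n\<close> on tape 4.\<close>
    define R where "R ys xs = (\<lambda>_::nat. [])(0 := xs, 1 := ys, 2 := s,
      3 := replicate (n - length ys) True, 4 := replicate (length ys - n) True)" for ys xs :: "bool list"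
    let ?L = "length (pair_code (desc_code (n, s)) x)"
    have L: "?L = 2 * (n + 1 + length s) + 1 + length x"
      by (simp add: length_pair_code desc_code_pair)
    let ?d = "desc_code (n, s)"
    have 1: "srun (unpair 0 1) (start (pair_code ?d x)) (9 * ?L + 1)
        ((\<lambda>_. [])(0 := False # x, 1 := rev ?d))"
      by (rule srun_weaken, rule srun_unpair) (auto simp: start_def fun_eq_iff)
    have 2: "srun (pop 0) ((\<lambda>_. [])(0 := False # x, 1 := rev ?d)) 1 ((\<lambda>_. [])(0 := x, 1 := rev ?d))"
      by (rule srun_weaken, rule srun_pop) (auto simp: fun_eq_iff)
    have 3: "srun (move 1 2) ((\<lambda>_. [])(0 := x, 1 := rev ?d)) (7 * length ?d + 1)
        ((\<lambda>_. [])(0 := x, 2 := ?d))"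
      by (rule srun_weaken, rule srun_move) (auto simp: fun_eq_iff)
    have 4: "srun (while_true 2 (push 3 True)) ((\<lambda>_. [])(0 := x, 2 := ?d)) (6 * n + 1)
        ((\<lambda>_. [])(0 := x, 2 := False # s, 3 := replicate n True))"
      by (rule srun_weaken, rule srun_while_true_unary[where zs = "False # s" and m = n])
         (auto simp: desc_code_pair fun_eq_iff)
    have 5: "srun (pop 2) ((\<lambda>_. [])(0 := x, 2 := False # s, 3 := replicate n True)) 1 Q"
      by (rule srun_weaken, rule srun_pop) (auto simp: Q_def fun_eq_iff)
    have decode: "srun ?decode (start (pair_code ?d x)) (25 * ?L + 20) Q"
      by (rule srun_weaken, rule runs_Seq[OF 1 runs_Seq[OF 2 runs_Seq[OF 3 runs_Seq[OF 4 5]]]], rule refl)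
         (use L in \<open>simp add: desc_code_pair\<close>)
    have body: "srun (Seq (push 1 b) (branch 3 (push 4 True) (pop 3) (pop 3)))
        ((R ys (b # xs))(0 := xs)) 8 (R (b # ys) xs)" for ys b xs
    proof -
      let ?r = "R (b # ys) xs"
      let ?r' = "(R ys (b # xs))(0 := xs, 1 := b # ys)"
      have "srun (branch 3 (push 4 True) (pop 3) (pop 3)) ?r' (Suc 3) ?r"
      proof (rule srun_branch, cases "length ys < n")
        case True
        then have "?r' 3 = True # replicate (n - Suc (length ys)) True"
          by (simp add: R_def Suc_diff_Suc[symmetric])
        then show "srun (case ?r' 3 of [] \<Rightarrow> push 4 True | b # _ \<Rightarrow> if b then pop 3 else pop 3) ?r' 3 ?r"
          using True by (simp, intro srun_weaken[OF srun_pop]) (auto simp: R_def fun_eq_iff)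
      next
        case False
        then have "?r' 3 = []" by (simp add: R_def)
        then show "srun (case ?r' 3 of [] \<Rightarrow> push 4 True | b # _ \<Rightarrow> if b then pop 3 else pop 3) ?r' 3 ?r"
          using False by (simp, intro srun_weaken[OF srun_push])
            (auto simp: R_def fun_eq_iff Suc_diff_le)
      qed
      moreover have "srun (push 1 b) ((R ys (b # xs))(0 := xs)) 3 ?r'"
        by (rule srun_weaken, rule srun_push) (auto simp: R_def fun_eq_iff)
      ultimately show ?thesis by (intro srun_weaken[OF runs_Seq]) auto
    qed
    have "srun ?check (R [] x) ((8 + 4) * length x + 1) (R (rev x @ []) [])"
      by (rule srun_each[where R = R, OF _ body]) (simp add: R_def)
    then have check: "srun ?check Q (12 * length x + 1) (R (rev x) [])"
      by (rule srun_change) (auto simp: Q_def R_def fun_eq_iff)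
    have move: "srun (move 1 0) (R (rev x) []) (7 * length x + 1) ((R (rev x) [])(0 := x, 1 := []))"
      by (rule srun_weaken, rule srun_move) (auto simp: R_def fun_eq_iff)
    have "yields ?fin ((R (rev x) [])(0 := x, 1 := []))
        (20 * (length x + length s + length v0 + length v1) + 50) (witness_query v0 v1 n s x)"
      using fin[of "(R (rev x) [])(0 := x, 1 := [])"]
      by (auto simp: R_def witness_query_def split: if_splits)
    from yields_Seq[OF move this lessI] have "yields (Seq (move 1 0) ?fin) (R (rev x) [])
      (Suc (7 * length x + 1 + (20 * (length x + length s + length v0 + length v1) + 50)))
      (witness_query v0 v1 n s x)" .
    from yields_Seq[OF decode yields_Seq[OF check this lessI] lessI] show ?thesis
      by (rule yields_mono) (use L in simp)
  qed
  show ?thesis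
  proof (rule polytime_solvable_stacks[where T = 5 and p = ?p and
        t = "\<lambda>n. 100 * n + 20 * (length v0 + length v1) + 200"])
    fix i :: "description \<times> bool list"
    show "\<exists>r. srun ?p (start (case i of (d, x) \<Rightarrow> pair_code (desc_code d) x))
        (100 * length (case i of (d, x) \<Rightarrow> pair_code (desc_code d) x) +
          20 * (length v0 + length v1) + 200) r \<and>
      (case i of (x, xa) \<Rightarrow> (case x of (n, s) \<Rightarrow> \<lambda>x y. y = witness_query v0 v1 n s x) xa) (r 0)"
      using main unfolding yields_def by (cases i) auto
  qed (auto intro!: poly_bounded_intros)
qed

section \<open>The max-min problem\<close>

lemma polytime_solvable_mono:
  assumes "polytime_solvable c J Q" "I \<subseteq> J" "\<And>i y. i \<in> I \<Longrightarrow> Q i y \<Longrightarrow> P i y"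
  shows "polytime_solvable c I P"
  using assms unfolding polytime_solvable_def by (meson subsetD)

lemma polytime_preimage:
  assumes "polytime_solvable c I (\<lambda>i y. y = h i)" "L \<in> PTIME"
  shows "polytime_solvable c I (\<lambda>i y. y = [h i \<in> L])"
  using assms(2) unfolding PTIME_def
  by (intro polytime_compose[OF assms(1), where e = "\<lambda>x. x" and J = UNIV]) auto

text \<open>The length bound 0 leaves only the empty witness, and the verifier looks at the first
  component alone. With this inclusion, P different from NP yields a language in NP outside
  P.\<close>

lemma PTIME_subset_NP: "PTIME \<subseteq> NP"
proof
  fix L assume L: "L \<in> PTIME"
  have "{z. code_fst z \<in> L} \<in> PTIME"
    using polytime_preimage[OF polytime_code_fst L] by (simp add: PTIME_def)
  moreover have "x \<in> L \<longleftrightarrow> (\<exists>u. length u \<le> 0 * length x ^ 0 + 0 \<and> pair_code x u \<in> {z. code_fst z \<in> L})" for x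
    by simp
  ultimately show "L \<in> NP" unfolding NP_def by blast
qed

lemma trivial_in_PTIME: "{} \<in> PTIME" "UNIV \<in> PTIME"
  using polytime_const[of "[False]"] polytime_const[of "[True]"] by (simp_all add: PTIME_def)

section \<open>Max-min and nominal values\<close>

lemma length_weights: "n \<ge> 2 \<Longrightarrow> length (weights n) = n"
  by (simp add: weights_def)

lemma weights_le: "i < length (weights n) \<Longrightarrow> weights n ! i \<le> 1"
  by (auto simp: weights_def nth_Cons')

lemma uncertainty_weights:
  assumes "n \<ge> 2"
  shows "uncertainty_set (weights n) 1 = {c. length c = n \<and> \<not> (c ! 0 \<and> c ! 1)}"
proof -
  obtain k where k: "n = Suc (Suc k)" using assms by (metis add_2_eq_Suc le_Suc_ex)
  have "(\<Sum>i<n. weights n ! i * of_bool (c ! i)) = of_bool (c ! 0) + of_bool (c ! 1)" for c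
    unfolding k by (simp add: weights_def sum.lessThan_Suc_shift del: sum.lessThan_Suc)
  then show ?thesis
    by (auto simp: uncertainty_set_def cube_def length_weights[OF assms])
qed

lemma finite_cube: "finite (cube n)"
  using finite_lists_length_eq[of "UNIV :: bool set" n] by (simp add: cube_def)

lemma finite_uncertainty_set: "finite (uncertainty_set w B)"
  by (rule finite_subset[OF _ finite_cube]) (auto simp: uncertainty_set_def)

lemma take_2_iff: "length x \<ge> 2 \<Longrightarrow> take 2 x = [True, True] \<longleftrightarrow> x ! 0 \<and> x ! 1"
  by (cases x; cases "tl x") auto

lemma maxmin_value_pos_iff:
  assumes n: "n \<ge> 2" and x: "length x = n"
  shows "maxmin_value (weights n) 1 x \<ge> 1 \<longleftrightarrow> take 2 x = [True, True]"
    and "take 2 x \<noteq> [True, True] \<Longrightarrow> maxmin_value (weights n) 1 x \<le> 0"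
proof -
  let ?U = "uncertainty_set (weights n) 1"
  let ?v = "\<lambda>c. \<Sum>i<length (weights n). (1 - of_bool (c ! i)) * of_bool (x ! i) :: int"
  have fin: "finite (?v ` ?U)" using finite_uncertainty_set by blast
  note U = uncertainty_weights[OF n]
  have take: "take 2 x = [True, True] \<longleftrightarrow> x ! 0 \<and> x ! 1" using take_2_iff n x by simp
  show *: "maxmin_value (weights n) 1 x \<le> 0" if "take 2 x \<noteq> [True, True]"
  proof -
    \<comment> \<open>The adversary answers with \<open>x\<close> itself, which is affordable when
      one of the first two bits is missing and cancels every chosen element.\<close>
    have "x \<in> ?U" using that x unfolding U take by simp
    moreover have "?v x = 0" by (intro sum.neutral) auto
    ultimately show ?thesis
      unfolding maxmin_value_def using Min_le[OF fin, of 0] by force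
  qed
  have "1 \<le> maxmin_value (weights n) 1 x" if TT: "take 2 x = [True, True]"
  proof -
    have "1 \<le> ?v c" if c: "c \<in> ?U" for c
    proof -
      \<comment> \<open>One of the first two coordinates escapes the adversary, and its term alone
        makes the sum at least 1.\<close>
      have "\<exists>i<n. x ! i \<and> \<not> c ! i"
        using c n TT unfolding U take by (cases "c ! 0") (auto intro: exI[of _ 0] exI[of _ "1::nat"])
      then obtain i where i: "i < n" "x ! i" "\<not> c ! i" by blast
      then have "1 = (1 - of_bool (c ! i)) * (of_bool (x ! i) :: int)" by simp
      also have "\<dots> \<le> ?v c"
        using i(1) by (intro member_le_sum) (auto simp: length_weights[OF n])
      finally show ?thesis .
    qed
    moreover have "replicate n False \<in> ?U" using n unfolding U by simp
    ultimately show ?thesis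
      unfolding maxmin_value_def using fin by (subst Min_ge_iff) auto
  qed
  with * show "maxmin_value (weights n) 1 x \<ge> 1 \<longleftrightarrow> take 2 x = [True, True]"
    by force
qed

lemma nominal_value_less: "False \<in> set x \<Longrightarrow> nominal_value x < length x"
proof -
  assume "False \<in> set x"
  then obtain i where "i < length x" "\<not> x ! i" by (metis in_set_conv_nth)
  then have "nominal_value x < (\<Sum>i<length x. 1)"
    unfolding nominal_value_def by (intro sum_strict_mono_ex1) auto
  then show ?thesis by simp
qed

lemma nominal_value_trivial: "nominal_value (False # replicate m True) = m"
  by (simp add: nominal_value_def sum.lessThan_Suc_shift del: sum.lessThan_Suc)

section \<open>The hard class of feasible sets and the reduction\<close>

locale hard_class =
  fixes V :: "bool list set" and a k :: nat and v0 v1 :: "bool list"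
  assumes V: "V \<in> PTIME" and v0: "v0 \<notin> V" and v1: "v1 \<in> V"
begin

definition L :: "bool list set" where
  "L = {s. \<exists>u. length u \<le> a * length s ^ k + a \<and> pair_code s u \<in> V}"

text \<open>The 3 added to the witness bound makes room for the two leading \<open>True\<close> and
  the separating \<open>False\<close>.\<close>

definition D :: "description set" where
  "D = {(n, s). n = a * length s ^ k + (a + 3)}"

definition X :: "description \<Rightarrow> bool list set" where
  "X = (\<lambda>(n, s). {x. witness_query v0 v1 n s x \<in> V})"

lemma X_length: "x \<in> X (n, s) \<Longrightarrow> length x = n"
  using v0 by (auto simp: X_def witness_query_def split: if_splits)

text \<open>On an all-ones vector the search for the separator finds none, so the query is the
  rejected word \<open>v0\<close>.\<close>

lemma X_False:
  assumes "x \<in> X (n, s)"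
  shows "False \<in> set x"
proof (rule ccontr)
  assume "False \<notin> set x"
  then have "\<forall>b\<in>set x. b" by (metis (full_types))
  moreover from this have "dropWhile id (tl (tl x)) = []"
    by (cases x; cases "tl x") auto
  ultimately have "witness_query v0 v1 n s x = v0"
    by (cases x; cases "tl x") (simp_all add: witness_query_def del: dropWhile_eq_Nil_conv)
  then show False using assms v0 by (simp add: X_def)
qed

lemma X_trivial: "n \<ge> 1 \<Longrightarrow> False # replicate (n - 1) True \<in> X (n, s)"
  using v1 by (simp add: X_def witness_query_def)

lemma X_witness:
  assumes "x \<in> X (n, s)" "take 2 x = [True, True]"
  obtains u where "length u + 3 \<le> n" "pair_code s u \<in> V"
proof -
  define r where "r = drop 2 x"
  have r: "x = True # True # r"
    unfolding r_def using append_take_drop_id[of 2 x] assms(2) by simp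
  have "witness_query v0 v1 n s x =
      (case dropWhile id r of [] \<Rightarrow> v0 | _ # u \<Rightarrow> pair_code s u)"
    using X_length[OF assms(1)] r by (simp add: witness_query_def)
  then have *: "(case dropWhile id r of [] \<Rightarrow> v0 | _ # u \<Rightarrow> pair_code s u) \<in> V"
    using assms(1) by (simp add: X_def)
  show thesis
  proof (cases "dropWhile id r")
    case Nil
    then show thesis using * v0 by (simp del: dropWhile_eq_Nil_conv)
  next
    case (Cons b u)
    \<comment> \<open>The separator takes one more coordinate after the leading pair, which gives
      \<open>length u + 3 \<le> n\<close>.\<close>
    then have "length u < length r" using length_dropWhile_le[of id r] by simp
    moreover have "pair_code s u \<in> V" using * Cons by simp
    ultimately show thesis using that[of u] X_length[OF assms(1)] r by simp
  qed
qed

lemma witness_X: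
  assumes "length u + 3 \<le> n" "pair_code s u \<in> V"
  obtains x where "x \<in> X (n, s)" "take 2 x = [True, True]"
proof -
  \<comment> \<open>Extra copies of \<open>True\<close> before the separator pad a shorter witness
    to exactly \<open>n\<close> coordinates.\<close>
  define j where "j = n - 3 - length u"
  have "dropWhile id (replicate j True @ False # u) = False # u" by (induction j) auto
  moreover have "j + length u + 3 = n" using assms(1) by (simp add: j_def)
  ultimately have "True # True # replicate j True @ False # u \<in> X (n, s)"
    using assms(2) by (auto simp: X_def witness_query_def)
  then show thesis using that by fastforce
qed

lemma feasible: "feasible_set_class D X"
proof -
  have "X d \<subseteq> cube (fst d)" for d
    using X_length by (cases d) (auto simp: cube_def)
  moreover have "polytime_solvable (\<lambda>(d, x). pair_code (desc_code d) x) (D \<times> UNIV)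
      (\<lambda>(d, x) y. y = [x \<in> X d])"
  proof (rule polytime_solvable_mono)
    have eq: "(\<lambda>((n, s), x) y. y = witness_query v0 v1 n s x) =
        (\<lambda>i y. y = (case i of ((n, s), x) \<Rightarrow> witness_query v0 v1 n s x))"
      by auto
    show "polytime_solvable (\<lambda>(d, x). pair_code (desc_code d) x) UNIV
        (\<lambda>i y. y = [(case i of ((n, s), x) \<Rightarrow> witness_query v0 v1 n s x) \<in> V])"
      by (rule polytime_preimage[OF polytime_witness_query[of v0 v1, unfolded eq] V])
  qed (auto simp: X_def)
  ultimately show ?thesis by (simp add: feasible_set_class_def)
qed

lemma nominal: "nominal_polytime D X"
  unfolding nominal_polytime_def
proof (rule polytime_solvable_mono[OF polytime_trivial_solution])
  fix d y assume d: "d \<in> D" and y: "(case d of (n, s) \<Rightarrow> \<lambda>y. y = False # replicate (n - 1) True) y"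
  obtain n s where ns: "d = (n, s)" by (cases d)
  have n: "n \<ge> 1" using d ns by (simp add: D_def)
  have "nominal_value x \<le> n - 1" if "x \<in> X d" for x
    using nominal_value_less[OF X_False] X_length that ns by fastforce
  then show "X d \<noteq> {} \<longrightarrow> y \<in> X d \<and> (\<forall>x\<in>X d. nominal_value x \<le> nominal_value y)"
    using X_trivial[OF n] y ns by (simp add: nominal_value_trivial)
qed (auto simp: D_def)

text \<open>A chain of polynomial-time maps: from \<open>s\<close> to its description, to the code
  of the weighted instance, to an approximate solution, and to the test of its first two
  bits.\<close>

lemma hard:
  assumes "maxmin_approximable \<alpha> D X" "\<alpha> > 0"
  shows "L \<in> PTIME"
proof -
  define N where "N s = a * length s ^ k + (a + 3)" for s :: "bool list"
  define inst where "inst s = ((N s, s), weights (N s), 1 :: nat)" for s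
  have N: "N s \<ge> 2" for s by (simp add: N_def)
  have desc: "polytime_solvable (\<lambda>s. s) UNIV (\<lambda>s y. y = desc_code (N s, s))"
    unfolding N_def by (rule polytime_power)
  have inst: "polytime_solvable (\<lambda>s. s) UNIV (\<lambda>s y. y = instance_code (inst s))"
    by (rule polytime_compose[OF desc polytime_encode]) (auto simp: inst_def desc_code_inject)
  have solve: "polytime_solvable (\<lambda>s. s) UNIV (\<lambda>s y. y \<in> X (N s, s) \<and>
      real_of_int (maxmin_value (weights (N s)) 1 y) \<ge>
        \<alpha> * real_of_int (maxmin_opt (weights (N s)) 1 (X (N s, s))))"
  proof (rule polytime_compose[OF inst assms(1)[unfolded maxmin_approximable_def]])
    fix s y assume y: "y = instance_code (inst s)"
    have "inst s \<in> maxmin_instances D"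
      using N weights_le[of _ "N s"] by (auto simp: inst_def maxmin_instances_def D_def N_def length_weights)
    \<comment> \<open>The trivial vector keeps the feasible set nonempty, so the approximation
      guarantee always applies.\<close>
    moreover have "X (N s, s) \<noteq> {}" using X_trivial[of "N s" s] N[of s] by auto
    ultimately show "\<exists>j\<in>maxmin_instances D. instance_code j = y \<and> (\<forall>z.
        (case j of (d, w, B) \<Rightarrow> \<lambda>y. X d \<noteq> {} \<longrightarrow> y \<in> X d \<and>
          \<alpha> * real_of_int (maxmin_opt w B (X d)) \<le> real_of_int (maxmin_value w B y)) z \<longrightarrow>
        z \<in> X (N s, s) \<and> \<alpha> * real_of_int (maxmin_opt (weights (N s)) 1 (X (N s, s)))
          \<le> real_of_int (maxmin_value (weights (N s)) 1 z))"
      using y by (intro bexI[of _ "inst s"]) (simp_all add: inst_def)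
  qed
  have "polytime_solvable (\<lambda>s. s) UNIV (\<lambda>s y. y = [s \<in> L])"
  proof (rule polytime_compose[OF solve polytime_starts_True_True])
    fix s y assume y: "y \<in> X (N s, s) \<and> real_of_int (maxmin_value (weights (N s)) 1 y) \<ge>
      \<alpha> * real_of_int (maxmin_opt (weights (N s)) 1 (X (N s, s)))"
    have "s \<in> L \<longleftrightarrow> take 2 y = [True, True]"
    proof
      assume "s \<in> L"
      then obtain u where "length u + 3 \<le> N s" "pair_code s u \<in> V" by (auto simp: L_def N_def)
      then obtain x where x: "x \<in> X (N s, s)" "take 2 x = [True, True]" by (rule witness_X)
      have "finite (X (N s, s))"
        by (rule finite_subset[OF _ finite_cube]) (auto simp: cube_def dest: X_length)
      then have "maxmin_value (weights (N s)) 1 x \<le> maxmin_opt (weights (N s)) 1 (X (N s, s))"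
        unfolding maxmin_opt_def using x(1) by (intro Max_ge) auto
      then have "maxmin_opt (weights (N s)) 1 (X (N s, s)) \<ge> 1"
        using maxmin_value_pos_iff(1)[OF N X_length[OF x(1)]] x(2) by linarith
      \<comment> \<open>Positivity of \<open>\<alpha>\<close> makes the guarantee strictly positive,
        however small the ratio; vectors without the leading pair have value at most 0 and are
        excluded.\<close>
      then have "\<alpha> * real_of_int (maxmin_opt (weights (N s)) 1 (X (N s, s))) > 0"
        using assms(2) by simp
      then have "maxmin_value (weights (N s)) 1 y > 0" using y by linarith
      then show "take 2 y = [True, True]"
        using maxmin_value_pos_iff(2)[OF N X_length[of y "N s" s]] y by force
    next
      \<comment> \<open>This direction uses only the feasibility of \<open>y\<close>: a feasible
        vector with this prefix contains a witness.\<close>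
      assume "take 2 y = [True, True]"
      then obtain u where "length u + 3 \<le> N s" "pair_code s u \<in> V" using X_witness y by blast
      then show "s \<in> L" by (auto simp: L_def N_def)
    qed
    then show "\<exists>j\<in>UNIV. j = y \<and> (\<forall>z. z = [take 2 j = [True, True]] \<longrightarrow> z = [s \<in> L])" by simp
  qed
  then show ?thesis by (simp add: PTIME_def)
qed

end

theorem corollary2:
  "\<exists>(D :: description set) (X :: description \<Rightarrow> bool list set).
     feasible_set_class D X \<and>
     nominal_polytime D X \<and>
     (PTIME \<noteq> NP \<longrightarrow> (\<forall>\<alpha>::real. \<alpha> > 0 \<longrightarrow> \<not> maxmin_approximable \<alpha> D X))"
proof (cases "PTIME = NP")
  case True
  \<comment> \<open>If P equals NP the hardness claim is vacuous, and the empty class has the two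
    remaining properties.\<close>
  have "polytime_solvable enc {} R" for enc :: "'i \<Rightarrow> bool list" and R
    by (rule polytime_solvable_stacks[where T = 1 and p = skip and t = "\<lambda>_. 1"])
       (auto intro: poly_bounded_const)
  then have "feasible_set_class {} (\<lambda>_. {})" "nominal_polytime {} (\<lambda>_. {})"
    by (simp_all add: feasible_set_class_def nominal_polytime_def)
  with True show ?thesis by blast
next
  case False
  then obtain L where L: "L \<in> NP" "L \<notin> PTIME" using PTIME_subset_NP by blast
  then obtain V a k where V: "V \<in> PTIME"
    and L_iff: "\<And>x. x \<in> L \<longleftrightarrow> (\<exists>u. length u \<le> a * length x ^ k + a \<and> pair_code x u \<in> V)"
    unfolding NP_def by blast
  \<comment> \<open>A verifier that rejects everything or accepts everything defines
    \<open>{}\<close> or \<open>UNIV\<close>, both in P. Hence \<open>V\<close> has the no-instance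
    and the yes-instance required by \<open>hard_class\<close>.\<close>
  have "V \<noteq> {}"
  proof
    assume "V = {}"
    then have "L = {}" using L_iff by auto
    then show False using L(2) trivial_in_PTIME by simp
  qed
  moreover have "V \<noteq> UNIV"
  proof
    assume "V = UNIV"
    then have "x \<in> L" for x unfolding L_iff by (intro exI[of _ "[]"]) simp
    then have "L = UNIV" by blast
    then show False using L(2) trivial_in_PTIME by simp
  qed
  ultimately obtain v0 v1 where v: "v0 \<notin> V" "v1 \<in> V" by blast
  interpret hard_class V a k v0 v1
    using V v by unfold_locales
  have "hard_class.L V a k = L" using L_iff by (auto simp: L_def)
  then have "\<forall>\<alpha>::real. \<alpha> > 0 \<longrightarrow> \<not> maxmin_approximable \<alpha> D X"
    using hard L(2) by metis
  then show ?thesis using feasible nominal by blast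
qed

end
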